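(* Let $K\subseteq[0,1]$ be a compact set and $s\in(1,2]$. Then for every $f\in H_s(K)$ there exists a compact subset $F\subseteq K$ such that (1) $\dim_H F=s-1$, and (2) the restriction $f|_F$ is nearly locally Lipschitz on $F$.
   Context: For $K\subseteq[0,1]$, $C(K)$ is the space of real-valued continuous functions on $K$, $G_f(X)=\{(x,f(x)):x\in X\}$, $\dim_H$ is Hausdorff dimension, and $H_s(K)=\{f\in C(K):\dim_H G_f(K)=s\}$. A function $f\in C(K)$ is called nearly locally Lipschitz on $K$ if for all but countably many points $x\in K$ there is $r_x>0$ such that $f$ is Lipschitz on $K\cap B(x,r_x)$, where $B(x,r)$ is the open ball of center $x$ and radius $r$. *)

theory Defs
  imports "HOL-Analysis.Analysis"
begin

definition hausdorff_content :: "real \<Rightarrow> real \<Rightarrow> 'a::metric_space set \<Rightarrow> ennreal" where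
  "hausdorff_content s \<delta> A =
     (INF U \<in> {U :: nat \<Rightarrow> 'a set. A \<subseteq> (\<Union>i. U i) \<and> (\<forall>i. bounded (U i) \<and> diameter (U i) \<le> \<delta>)}.
        (\<Sum>i. ennreal (diameter (U i) powr s)))"

definition hausdorff_measure :: "real \<Rightarrow> 'a::metric_space set \<Rightarrow> ennreal" where
  "hausdorff_measure s A = (SUP \<delta> \<in> {0<..}. hausdorff_content s \<delta> A)"

definition hausdorff_dim :: "'a::metric_space set \<Rightarrow> ereal" where
  "hausdorff_dim A = Inf {ereal s | s. s \<ge> 0 \<and> hausdorff_measure s A = 0}"

definition graph_on :: "real set \<Rightarrow> (real \<Rightarrow> real) \<Rightarrow> (real \<times> real) set" where
  "graph_on X f = (\<lambda>x. (x, f x)) ` X"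

definition H_class :: "real set \<Rightarrow> real \<Rightarrow> (real \<Rightarrow> real) set" where
  "H_class K s = {f. continuous_on K f \<and> hausdorff_dim (graph_on K f) = ereal s}"

definition nearly_locally_lipschitz_on :: "real set \<Rightarrow> (real \<Rightarrow> real) \<Rightarrow> bool" where
  "nearly_locally_lipschitz_on K f \<longleftrightarrow>
     countable {x \<in> K. \<not> (\<exists>r>0. \<exists>L. L-lipschitz_on (K \<inter> ball x r) f)}"

end

theory Submission
  imports Defs
begin

text \<open>
  Over a line \<open>y = a * x + b\<close> with \<open>a \<in> [0, 1]\<close> that meets the graph \<open>G\<close>, the function is
  1-Lipschitz, so it suffices to find lines whose slices of \<open>G\<close> have dimension close to \<open>s - 1\<close>
  and none above.  Null sets of dimension \<open>t > s\<close> have null slices of dimension \<open>t - 1\<close> along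
  almost every line, which gives the upper bound.  For the lower bound, a Frostman lemma at scale
  \<open>\<delta> = 2\<^sup>-\<^sup>N\<close> puts weights on finitely many points of \<open>G\<close>, with total mass bounded below and bounded
  \<open>(u + 1)\<close>-energy for \<open>u + 1 < s\<close>.  Two points at distance \<open>D\<close> are both \<open>\<delta>\<close>-close to a random line
  with probability \<open>O(\<delta>\<^sup>2 / D)\<close>, so the weights near a random line, divided by \<open>\<delta>\<close>, have on average
  mass bounded below and bounded \<open>u\<close>-energy.  If almost every slice were \<open>u\<close>-null, the ratio
  \<open>mass\<^sup>2 / energy\<close> would tend to 0 almost everywhere as \<open>N\<close> grows, contradicting dominated
  convergence; no limit measure is needed.  Finally, slices in disjoint annuli shrinking to a
  point near which the graph has full dimension are collected into a compact set of dimension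
  exactly \<open>s - 1\<close>.
\<close>

subsection \<open>Null sets of Hausdorff measures\<close>

text \<open>Only the vanishing of the measure enters \<open>hausdorff_dim\<close>, so this cover
  criterion carries the whole development.\<close>

lemma hausdorff_measure_eq_0_iff:
  "hausdorff_measure s A = 0 \<longleftrightarrow>
     (\<forall>\<delta>>0. \<forall>\<epsilon>>0. \<exists>U :: nat \<Rightarrow> 'a::metric_space set. A \<subseteq> (\<Union>i. U i) \<and>
        (\<forall>i. bounded (U i) \<and> diameter (U i) \<le> \<delta>) \<and>
        (\<Sum>i. ennreal (diameter (U i) powr s)) < ennreal \<epsilon>)"
proof -
  have "hausdorff_measure s A = 0 \<longleftrightarrow> (\<forall>\<delta>>0. hausdorff_content s \<delta> A = 0)"
    unfolding hausdorff_measure_def bot_ennreal[symmetric] SUP_bot_conv by auto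
  also have "\<dots> \<longleftrightarrow> (\<forall>\<delta>>0. \<forall>\<epsilon>>0. hausdorff_content s \<delta> A < ennreal \<epsilon>)"
  proof -
    have "x = 0 \<longleftrightarrow> (\<forall>\<epsilon>>0. x < ennreal \<epsilon>)" for x :: ennreal
    proof
      assume *: "\<forall>\<epsilon>>0. x < ennreal \<epsilon>"
      show "x = 0"
      proof (cases x)
        case (real r)
        then show ?thesis using *[rule_format, of r] by (cases "r = 0") auto
      next
        case top
        then show ?thesis using *[rule_format, of 1] by auto
      qed
    qed auto
    then show ?thesis by (simp only:)
  qed
  finally show ?thesis
    unfolding hausdorff_content_def INF_less_iff by (simp add: Bex_def conj_assoc)
qed

lemma hausdorff_measure_nullI:
  fixes A :: "'a::metric_space set"
  assumes "\<And>\<delta> \<epsilon>. \<delta> > 0 \<Longrightarrow> \<epsilon> > 0 \<Longrightarrow> \<exists>U :: nat \<Rightarrow> 'a set. A \<subseteq> (\<Union>i. U i) \<and>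
        (\<forall>i. bounded (U i) \<and> diameter (U i) \<le> \<delta>) \<and>
        (\<Sum>i. ennreal (diameter (U i) powr s)) < ennreal \<epsilon>"
  shows "hausdorff_measure s A = 0"
  using assms unfolding hausdorff_measure_eq_0_iff by blast

lemma hausdorff_measure_nullE:
  fixes A :: "'a::metric_space set"
  assumes "hausdorff_measure s A = 0" "\<delta> > 0" "\<epsilon> > 0"
  obtains U :: "nat \<Rightarrow> 'a set" where "A \<subseteq> (\<Union>i. U i)"
    "\<And>i. bounded (U i)" "\<And>i. diameter (U i) \<le> \<delta>"
    "(\<Sum>i. ennreal (diameter (U i) powr s)) < ennreal \<epsilon>"
  using assms(1)[unfolded hausdorff_measure_eq_0_iff, rule_format, OF assms(2,3)]
  by (elim exE conjE) (rule that, auto)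

lemma hausdorff_measure_null_mono:
  fixes A B :: "'a::metric_space set"
  assumes "A \<subseteq> B" "hausdorff_measure s B = 0"
  shows "hausdorff_measure s A = 0"
proof (rule hausdorff_measure_nullI)
  fix \<delta> \<epsilon> :: real assume "\<delta> > 0" "\<epsilon> > 0"
  from hausdorff_measure_nullE[OF assms(2) this]
  obtain U :: "nat \<Rightarrow> 'a set" where "B \<subseteq> (\<Union>i. U i)"
    "\<And>i. bounded (U i)" "\<And>i. diameter (U i) \<le> \<delta>"
    "(\<Sum>i. ennreal (diameter (U i) powr s)) < ennreal \<epsilon>" by metis
  then show "\<exists>U :: nat \<Rightarrow> 'a set. A \<subseteq> (\<Union>i. U i) \<and> (\<forall>i. bounded (U i) \<and> diameter (U i) \<le> \<delta>) \<and>
      (\<Sum>i. ennreal (diameter (U i) powr s)) < ennreal \<epsilon>"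
    using assms(1) by (intro exI[of _ U]) auto
qed

lemma hausdorff_measure_null_exponent:
  fixes A :: "'a::metric_space set"
  assumes "hausdorff_measure s A = 0" "s \<le> s'"
  shows "hausdorff_measure s' A = 0"
proof (rule hausdorff_measure_nullI)
  fix \<delta> \<epsilon> :: real assume "\<delta> > 0" and "\<epsilon> > 0"
  \<comment> \<open>Diameters at most 1 make the terms of the sum decrease as the exponent
    grows.\<close>
  then have "min \<delta> 1 > 0" by simp
  from hausdorff_measure_nullE[OF assms(1) this \<open>\<epsilon> > 0\<close>]
  obtain U :: "nat \<Rightarrow> 'a set" where U: "A \<subseteq> (\<Union>i. U i)" "\<And>i. bounded (U i)"
    "\<And>i. diameter (U i) \<le> min \<delta> 1" "(\<Sum>i. ennreal (diameter (U i) powr s)) < ennreal \<epsilon>"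
    by metis
  have "(\<Sum>i. ennreal (diameter (U i) powr s')) \<le> (\<Sum>i. ennreal (diameter (U i) powr s))"
    using U(2,3) assms(2)
    by (intro suminf_le summableI ennreal_leI powr_mono') (auto intro!: diameter_ge_0)
  also note U(4)
  finally show "\<exists>U. A \<subseteq> (\<Union>i. U i) \<and> (\<forall>i. bounded (U i) \<and> diameter (U i) \<le> \<delta>) \<and>
      (\<Sum>i::nat. ennreal (diameter (U i) powr s')) < ennreal \<epsilon>"
    using U(1-3) by (intro exI[of _ U]) auto
qed

text \<open>Since \<open>0 powr s = 0\<close> even for \<open>s = 0\<close>, points are null in
  every exponent; the infimum that defines the dimension is unaffected.\<close>

lemma hausdorff_measure_singleton [simp]: "hausdorff_measure s {x} = 0"
  by (rule hausdorff_measure_nullI) (intro exI[of _ "\<lambda>_. {x}"], auto)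

lemma hausdorff_measure_empty [simp]: "hausdorff_measure s {} = 0"
  by (rule hausdorff_measure_null_mono[OF _ hausdorff_measure_singleton]) auto

lemma hausdorff_measure_null_UN:
  fixes A :: "nat \<Rightarrow> 'a::metric_space set"
  assumes "\<And>i. hausdorff_measure s (A i) = 0"
  shows "hausdorff_measure s (\<Union>i. A i) = 0"
proof (rule hausdorff_measure_nullI)
  fix \<delta> \<epsilon> :: real assume pos: "\<delta> > 0" "\<epsilon> > 0"
  \<comment> \<open>The budgets add up to \<open>\<epsilon> / 2\<close>: comparing series gives only
    a non-strict bound, and the other half restores strictness.\<close>
  define P where "P i U \<longleftrightarrow> A i \<subseteq> (\<Union>j::nat. U j) \<and> (\<forall>j. bounded (U j)) \<and> (\<forall>j. diameter (U j) \<le> \<delta>) \<and>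
      (\<Sum>j. ennreal (diameter (U j) powr s)) < ennreal (\<epsilon> / 2 * (1/2) ^ Suc i)" for i U
  have "\<exists>U. P i U" for i
    by (rule hausdorff_measure_nullE[OF assms, of \<delta> "\<epsilon> / 2 * (1/2) ^ Suc i" i])
      (use pos in \<open>auto simp: P_def\<close>)
  then obtain U where "\<And>i. P i (U i)" by metis
  then have U: "\<And>i. A i \<subseteq> (\<Union>j. U i j)" "\<And>i j. bounded (U i j)" "\<And>i j. diameter (U i j) \<le> \<delta>"
    "\<And>i. (\<Sum>j. ennreal (diameter (U i j) powr s)) < ennreal (\<epsilon> / 2 * (1/2) ^ Suc i)"
    unfolding P_def by auto
  define V where "V n = (case prod_decode n of (i, j) \<Rightarrow> U i j)" for n
  have "(\<Sum>n. ennreal (diameter (V n) powr s)) = (\<Sum>i. \<Sum>j. ennreal (diameter (U i j) powr s))"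
    using suminf_ennreal_2dimen[of _ "\<lambda>(i, j). ennreal (diameter (U i j) powr s)", OF refl]
    by (simp add: V_def case_prod_unfold)
  also have "\<dots> \<le> (\<Sum>i. ennreal (\<epsilon> / 2 * (1/2) ^ Suc i))"
    using U(4) by (intro suminf_le summableI less_imp_le) auto
  also have "\<dots> = ennreal (\<epsilon> / 2)"
    using pos power_half_series[THEN sums_mult, of "\<epsilon> / 2"]
    by (intro suminf_ennreal_eq) auto
  also have "\<dots> < ennreal \<epsilon>" using pos by (auto intro!: ennreal_lessI)
  finally have sum: "(\<Sum>n. ennreal (diameter (V n) powr s)) < ennreal \<epsilon>" .
  have "(\<Union>i. A i) \<subseteq> (\<Union>n. V n)"
  proof
    fix x assume "x \<in> (\<Union>i. A i)"
    then obtain i j where "x \<in> U i j" using U(1) by blast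
    then have "x \<in> V (prod_encode (i, j))" by (simp add: V_def)
    then show "x \<in> (\<Union>n. V n)" by blast
  qed
  moreover have "\<forall>n. bounded (V n) \<and> diameter (V n) \<le> \<delta>"
    using U(2,3) by (auto simp: V_def split: prod.splits)
  ultimately show "\<exists>V. (\<Union>i. A i) \<subseteq> (\<Union>i. V i) \<and> (\<forall>i. bounded (V i) \<and> diameter (V i) \<le> \<delta>) \<and>
      (\<Sum>i::nat. ennreal (diameter (V i) powr s)) < ennreal \<epsilon>"
    using sum by blast
qed

lemma hausdorff_measure_null_countable_UN:
  assumes "countable I" "\<And>i. i \<in> I \<Longrightarrow> hausdorff_measure s (A i) = 0"
  shows "hausdorff_measure s (\<Union>i\<in>I. A i) = 0"
proof (cases "I = {}")
  case False
  then have "(\<Union>i\<in>I. A i) = (\<Union>n. A (from_nat_into I n))"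
    using assms(1) range_from_nat_into[of I] by (metis image_image)
  then show ?thesis
    using assms False hausdorff_measure_null_UN[of s "\<lambda>n. A (from_nat_into I n)"]
    by (simp add: from_nat_into)
qed auto

lemma hausdorff_measure_null_Un:
  assumes "hausdorff_measure s A = 0" "hausdorff_measure s B = 0"
  shows "hausdorff_measure s (A \<union> B) = 0"
proof -
  have "hausdorff_measure s (\<Union>b\<in>UNIV. if b then A else B) = 0"
    using assms by (intro hausdorff_measure_null_countable_UN) auto
  then show ?thesis by (simp add: UNIV_bool Un_commute)
qed

section \<open>Null exponents and dimension\<close>

lemma hausdorff_measure_below_dim:
  assumes "hausdorff_dim A = ereal s" "0 \<le> t" "t < s"
  shows "hausdorff_measure t A \<noteq> 0"
proof
  assume "hausdorff_measure t A = 0"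
  then have "hausdorff_dim A \<le> ereal t"
    unfolding hausdorff_dim_def using assms by (intro Inf_lower) auto
  then show False using assms by simp
qed

lemma hausdorff_measure_above_dim:
  assumes "hausdorff_dim A = ereal s" "s < t"
  shows "hausdorff_measure t A = 0"
proof -
  have "hausdorff_dim A < ereal t" using assms by simp
  then obtain r where "hausdorff_measure r A = 0" "r < t"
    unfolding hausdorff_dim_def Inf_less_iff by auto
  then show ?thesis using hausdorff_measure_null_exponent[of r A t] by simp
qed

text \<open>The upper bound is asked only along a sequence of exponents: countably many exponents
  can be treated at once for almost every line.\<close>

lemma hausdorff_dim_eqI:
  assumes "0 \<le> s" "\<And>n::nat. hausdorff_measure (s + 1 / (real n + 1)) A = 0"
    and "\<And>t. 0 \<le> t \<Longrightarrow> t < s \<Longrightarrow> hausdorff_measure t A \<noteq> 0"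
  shows "hausdorff_dim A = ereal s"
proof (rule antisym)
  have "hausdorff_dim A \<le> ereal (s + 1 / (real n + 1))" for n
    unfolding hausdorff_dim_def using assms by (intro Inf_lower) auto
  moreover have "(\<lambda>n. ereal (s + 1 / (real n + 1))) \<longlonglongrightarrow> ereal (s + 0)"
    using LIMSEQ_inverse_real_of_nat
    by (intro tendsto_ereal tendsto_add tendsto_const) (simp add: inverse_eq_divide add.commute)
  ultimately show "hausdorff_dim A \<le> ereal s"
    by (intro LIMSEQ_le_const[where X = "\<lambda>n. ereal (s + 1 / (real n + 1))"]) auto
  show "ereal s \<le> hausdorff_dim A"
    unfolding hausdorff_dim_def using assms(3) by (intro Inf_greatest) (auto simp: not_less[symmetric])
qed

subsection \<open>Slices of null sets\<close>

text \<open>Tonelli: over each slope in \<open>T\<close> the admissible intercepts fill an interval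
  of length \<open>2 * r\<close>. With \<open>g a = y - a * x\<close> this measures the lines
  passing near the point \<open>(x, y)\<close>.\<close>

lemma emeasure_lborel_strip:
  fixes g :: "real \<Rightarrow> real"
  assumes [measurable]: "T \<in> sets borel" "g \<in> borel_measurable borel" and "0 \<le> r"
  shows "{p. fst p \<in> T \<and> \<bar>g (fst p) - snd p\<bar> \<le> r} \<in> sets borel"
    and "emeasure lborel {p. fst p \<in> T \<and> \<bar>g (fst p) - snd p\<bar> \<le> r} = ennreal (2 * r) * emeasure lborel T"
proof -
  let ?S = "{p. fst p \<in> T \<and> \<bar>g (fst p) - snd p\<bar> \<le> r}"
  have "{p \<in> space (borel \<Otimes>\<^sub>M borel). fst p \<in> T \<and> \<bar>g (fst p) - snd p\<bar> \<le> r} \<in> sets (borel \<Otimes>\<^sub>M borel)"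
    by measurable
  then have S: "?S \<in> sets (borel \<Otimes>\<^sub>M borel)" by (simp add: space_pair_measure)
  then show "?S \<in> sets borel" by (simp only: borel_prod)
  have "emeasure lborel ?S = emeasure (lborel \<Otimes>\<^sub>M lborel) ?S"
    by (simp add: lborel_prod)
  also have "\<dots> = (\<integral>\<^sup>+ a. emeasure lborel (Pair a -` ?S) \<partial>lborel)"
    using S by (intro lborel.emeasure_pair_measure_alt) simp
  also have "\<dots> = (\<integral>\<^sup>+ a. ennreal (2 * r) * indicator T a \<partial>lborel)"
  proof (rule nn_integral_cong)
    fix a :: real
    have "Pair a -` ?S = (if a \<in> T then {g a - r..g a + r} else {})" by auto
    then show "emeasure lborel (Pair a -` ?S) = ennreal (2 * r) * indicator T a"
      using assms(3) by simp
  qed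
  finally show "emeasure lborel ?S = ennreal (2 * r) * emeasure lborel T"
    by (simp add: nn_integral_cmult_indicator)
qed

text \<open>A line of slope at most 1 that meets a set of diameter \<open>d\<close> passes within vertical
  distance \<open>2 * d\<close> of any given point of it.  Such lines have measure \<open>4 * d\<close>, so integrating
  over the lines turns a \<open>t\<close>-dimensional cover into a \<open>t - 1\<close>-dimensional cover of the slices.\<close>

lemma AE_hausdorff_measure_slice_null:
  fixes A :: "(real \<times> real) set"
  assumes "1 < t" "hausdorff_measure t A = 0"
  shows "AE p in lborel. fst p \<in> {0..1} \<longrightarrow>
           hausdorff_measure (t - 1) {x. (x, fst p * x + snd p) \<in> A} = 0"
proof -
  \<comment> \<open>The index \<open>m\<close> controls the diameters and \<open>n\<close> the sum.
    Countably many covers are fixed in advance, so that one exceptional set of lines serves them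
    all.\<close>
  define P where "P m n U \<longleftrightarrow> A \<subseteq> (\<Union>i::nat. U i) \<and> (\<forall>i. bounded (U i)) \<and>
      (\<forall>i. diameter (U i) \<le> 1 / (real m + 1)) \<and>
      (\<Sum>i. ennreal (diameter (U i) powr t)) < ennreal (1 / (real n + 1))" for m n U
  have "\<exists>U. P m n U" for m n
    by (rule hausdorff_measure_nullE[OF assms(2), of "1 / (real m + 1)" "1 / (real n + 1)"])
      (auto simp: P_def)
  then obtain U where "\<And>m n. P m n (U m n)" by metis
  then have U: "\<And>m n. A \<subseteq> (\<Union>i. U m n i)" "\<And>m n i. bounded (U m n i)"
    "\<And>m n i. diameter (U m n i) \<le> 1 / (real m + 1)"
    "\<And>m n. (\<Sum>i. ennreal (diameter (U m n i) powr t)) < ennreal (1 / (real n + 1))"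
    unfolding P_def by auto
  define d where "d m n i = diameter (U m n i)" for m n i
  have d0: "d m n i \<ge> 0" for m n i unfolding d_def by (intro diameter_ge_0 U)
  define c where "c m n i = (SOME q. q \<in> U m n i)" for m n i
  have c: "c m n i \<in> U m n i" if "q \<in> U m n i" for q m n i
    unfolding c_def using that by (rule someI)
  define S where "S m n i = {p. fst p \<in> {0..1} \<and>
      \<bar>(snd (c m n i) - fst p * fst (c m n i)) - snd p\<bar> \<le> 2 * d m n i}" for m n i
  have S [measurable]: "S m n i \<in> sets borel"
    and emeasure_S: "emeasure lborel (S m n i) = ennreal (4 * d m n i)" for m n i
    using emeasure_lborel_strip[of "{0..1}" "\<lambda>a. snd (c m n i) - a * fst (c m n i)" "2 * d m n i"] d0[of m n i]
    unfolding S_def by auto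
  \<comment> \<open>\<open>g m n p\<close> dominates the \<open>(t - 1)\<close>-sum of the slice of
    the cover \<open>U m n\<close> along the line \<open>p\<close>, while its integral is of order
    \<open>1 / n\<close>.\<close>
  define g where "g m n p = (\<Sum>i. ennreal (d m n i powr (t - 1)) * indicator (S m n i) p)" for m n p
  have g [measurable]: "g m n \<in> borel_measurable lborel" for m n
    unfolding g_def by measurable
  have int_g: "(\<integral>\<^sup>+ p. g m n p \<partial>lborel) \<le> ennreal (4 / (real n + 1))" for m n
  proof -
    have "(\<integral>\<^sup>+ p. g m n p \<partial>lborel) = (\<Sum>i. ennreal (d m n i powr (t - 1)) * ennreal (4 * d m n i))"
      unfolding g_def by (subst nn_integral_suminf) (auto simp: nn_integral_cmult_indicator S emeasure_S)
    also have "\<dots> = (\<Sum>i. 4 * ennreal (d m n i powr t))"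
    proof (intro suminf_cong)
      fix i
      have "d m n i powr (t - 1) * (4 * d m n i) = 4 * d m n i powr t"
        using d0[of m n i] by (cases "d m n i = 0") (simp_all add: powr_diff)
      then have "ennreal (d m n i powr (t - 1) * (4 * d m n i)) = ennreal (4 * d m n i powr t)"
        by (rule arg_cong)
      then show "ennreal (d m n i powr (t - 1)) * ennreal (4 * d m n i) = 4 * ennreal (d m n i powr t)"
        by (simp only: ennreal_mult' powr_ge_zero ennreal_numeral zero_le_numeral)
    qed
    also have "\<dots> = 4 * (\<Sum>i. ennreal (d m n i powr t))" by simp
    also have "\<dots> \<le> 4 * ennreal (1 / (real n + 1))"
      using U(4)[of m n] by (intro mult_left_mono) (auto simp: d_def)
    also have "\<dots> = ennreal (4 / (real n + 1))"
      by (simp add: ennreal_mult'[symmetric] flip: ennreal_numeral)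
    finally show ?thesis .
  qed
  \<comment> \<open>The infimum lies below every \<open>g m n\<close>, and their integrals tend to 0
    with \<open>n\<close>.\<close>
  have "AE p in lborel. (INF n. g m n p) = 0" for m
  proof -
    have "(\<integral>\<^sup>+ p. (INF n. g m n p) \<partial>lborel) \<le> ennreal (4 / (real n + 1))" for n
      by (rule order_trans[OF nn_integral_mono int_g[of m n]]) (rule INF_lower, simp)
    moreover have "(\<lambda>n. ennreal (4 / (real n + 1))) \<longlonglongrightarrow> ennreal 0"
      using tendsto_mult[OF tendsto_const[of 4] LIMSEQ_inverse_real_of_nat]
      by (intro tendsto_ennrealI) (simp add: inverse_eq_divide add.commute)
    ultimately have "(\<integral>\<^sup>+ p. (INF n. g m n p) \<partial>lborel) \<le> ennreal 0"
      by (intro LIMSEQ_le_const[where X = "\<lambda>n. ennreal (4 / (real n + 1))"]) auto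
    then show ?thesis
      by (subst nn_integral_0_iff_AE[symmetric]) auto
  qed
  then have "AE p in lborel. \<forall>m. (INF n. g m n p) = 0"
    by (simp add: AE_all_countable)
  then show ?thesis
  proof eventually_elim
    case (elim p)
    show ?case
    proof
      assume p: "fst p \<in> {0..1}"
      show "hausdorff_measure (t - 1) {x. (x, fst p * x + snd p) \<in> A} = 0"
      proof (rule hausdorff_measure_nullI)
        fix \<delta> \<epsilon> :: real assume "\<delta> > 0" "\<epsilon> > 0"
        obtain m :: nat where m: "1 / (real m + 1) \<le> \<delta>"
          using reals_Archimedean[OF \<open>\<delta> > 0\<close>]
          by (metis inverse_eq_divide less_imp_le of_nat_Suc add.commute)
        have "(INF n. g m n p) < ennreal \<epsilon>" using elim \<open>\<epsilon> > 0\<close> by simp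
        then obtain n where n: "g m n p < ennreal \<epsilon>" unfolding INF_less_iff by auto
        \<comment> \<open>The shadow on the first axis of the part of \<open>U m n i\<close> met by
          the line; projecting does not increase diameters.\<close>
        define V where "V i = {x. (x, fst p * x + snd p) \<in> U m n i}" for i
        have Vsub: "V i \<subseteq> fst ` U m n i" for i
          unfolding V_def by force
        have bV: "bounded (V i)" for i
          by (rule bounded_subset[OF bounded_fst[OF U(2)] Vsub])
        have dist_le: "dist q q' \<le> d m n i" if "q \<in> U m n i" "q' \<in> U m n i" for q q' i
          unfolding d_def by (rule diameter_bounded_bound[OF U(2) that])
        have dV: "diameter (V i) \<le> d m n i" for i
        proof (rule diameter_le)
          fix x y assume "x \<in> V i" "y \<in> V i"
          then have "dist (x, fst p * x + snd p) (y, fst p * y + snd p) \<le> d m n i"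
            by (intro dist_le) (auto simp: V_def)
          then show "norm (x - y) \<le> d m n i"
            using dist_fst_le[of "(x, fst p * x + snd p)" "(y, fst p * y + snd p)"]
            by (simp add: dist_norm)
        qed (use d0 in auto)
        have "ennreal (diameter (V i) powr (t - 1)) \<le> ennreal (d m n i powr (t - 1)) * indicator (S m n i) p" for i
        proof (cases "V i = {}")
          case False
          then obtain x where x: "(x, fst p * x + snd p) \<in> U m n i" by (auto simp: V_def)
          define q where "q = c m n i"
          have "q \<in> U m n i" unfolding q_def by (rule c[OF x])
          then have "dist q (x, fst p * x + snd p) \<le> d m n i" by (rule dist_le[OF _ x])
          then have 1: "\<bar>fst q - x\<bar> \<le> d m n i" and 2: "\<bar>snd q - (fst p * x + snd p)\<bar> \<le> d m n i"
            using dist_fst_le[of q "(x, fst p * x + snd p)"] dist_snd_le[of q "(x, fst p * x + snd p)"]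
            by (auto simp: dist_real_def)
          have "\<bar>fst p * (x - fst q)\<bar> \<le> 1 * d m n i"
            unfolding abs_mult using 1 p by (intro mult_mono) auto
          moreover have "snd q - fst p * fst q - snd p = (snd q - (fst p * x + snd p)) + fst p * (x - fst q)"
            by (simp add: algebra_simps)
          ultimately have "\<bar>snd q - fst p * fst q - snd p\<bar> \<le> 2 * d m n i" using 2 by linarith
          then have "p \<in> S m n i" using p by (auto simp: S_def q_def)
          then show ?thesis
            using dV[of i] assms(1) bV by (auto intro!: ennreal_leI powr_mono2 diameter_ge_0)
        qed simp
        then have "(\<Sum>i. ennreal (diameter (V i) powr (t - 1))) \<le> g m n p"
          unfolding g_def by (intro suminf_le) auto
        also note n
        finally have sum: "(\<Sum>i. ennreal (diameter (V i) powr (t - 1))) < ennreal \<epsilon>" .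
        have "{x. (x, fst p * x + snd p) \<in> A} \<subseteq> (\<Union>i. V i)"
          using U(1)[of m n] by (auto simp: V_def)
        moreover have "diameter (V i) \<le> \<delta>" for i
          using dV[of i] U(3)[of m n i] m unfolding d_def by linarith
        ultimately show "\<exists>V. {x. (x, fst p * x + snd p) \<in> A} \<subseteq> (\<Union>i. V i) \<and>
            (\<forall>i. bounded (V i) \<and> diameter (V i) \<le> \<delta>) \<and>
            (\<Sum>i::nat. ennreal (diameter (V i) powr (t - 1))) < ennreal \<epsilon>"
          using bV sum by (intro exI[of _ V]) auto
      qed
    qed
  qed
qed

subsection \<open>A discrete Frostman lemma\<close>

text \<open>Points are inserted one at a time, each with the largest weight that its cells still admit.\<close>

lemma greedy_weights:
  fixes c :: "nat \<Rightarrow> 'a \<Rightarrow> 'b" and \<kappa> :: "nat \<Rightarrow> real"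
  assumes "finite P" "\<And>m. 0 \<le> \<kappa> m"
  shows "\<exists>\<nu>. (\<forall>x. 0 \<le> \<nu> x) \<and> (\<forall>m\<le>N. \<forall>q. sum \<nu> {x \<in> P. c m x = q} \<le> \<kappa> m) \<and>
           (\<forall>x\<in>P. \<exists>m\<le>N. sum \<nu> {y \<in> P. c m y = c m x} = \<kappa> m)"
  using assms(1)
proof (induction P rule: finite_induct)
  case empty
  then show ?case using assms(2) by (intro exI[of _ "\<lambda>_. 0"]) auto
next
  case (insert x P)
  from insert.IH obtain \<nu> where IH: "(\<forall>x. 0 \<le> \<nu> x) \<and> (\<forall>m\<le>N. \<forall>q. sum \<nu> {x \<in> P. c m x = q} \<le> \<kappa> m) \<and>
      (\<forall>x\<in>P. \<exists>m\<le>N. sum \<nu> {y \<in> P. c m y = c m x} = \<kappa> m)" ..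
  have \<nu>: "\<And>x. 0 \<le> \<nu> x" "\<And>m q. m \<le> N \<Longrightarrow> sum \<nu> {x \<in> P. c m x = q} \<le> \<kappa> m"
    "\<And>x. x \<in> P \<Longrightarrow> \<exists>m\<le>N. sum \<nu> {y \<in> P. c m y = c m x} = \<kappa> m"
    using IH by blast+
  \<comment> \<open>The new point receives the smallest slack among its cells: no cap is exceeded,
    and the level attaining the minimum becomes saturated.\<close>
  define slack where "slack m = \<kappa> m - sum \<nu> {y \<in> P. c m y = c m x}" for m
  define s where "s = Min (slack ` {..N})"
  define \<nu>' where "\<nu>' = \<nu>(x := s)"
  have s_le: "s \<le> slack m" if "m \<le> N" for m
    unfolding s_def using that by (intro Min_le) auto
  have "s \<in> slack ` {..N}" unfolding s_def by (intro Min_in) auto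
  then obtain m0 where m0: "m0 \<le> N" "s = slack m0" by auto
  have s0: "0 \<le> s" using m0 \<nu>(2)[of m0] by (simp add: slack_def)
  have sum': "sum \<nu>' {y \<in> insert x P. c m y = q} =
      (if c m x = q then s else 0) + sum \<nu> {y \<in> P. c m y = q}" for m q
  proof -
    have "sum \<nu>' {y \<in> P. c m y = q} = sum \<nu> {y \<in> P. c m y = q}"
      using insert.hyps by (intro sum.cong) (auto simp: \<nu>'_def)
    moreover have "{y \<in> insert x P. c m y = q} =
        (if c m x = q then insert x {y \<in> P. c m y = q} else {y \<in> P. c m y = q})" by auto
    ultimately show ?thesis using insert.hyps by (simp add: \<nu>'_def)
  qed
  have cap: "sum \<nu>' {y \<in> insert x P. c m y = q} \<le> \<kappa> m" if "m \<le> N" for m q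
    using \<nu>(2)[OF that, of q] s_le[OF that] unfolding sum' slack_def by auto
  have "\<exists>m\<le>N. sum \<nu>' {y \<in> insert x P. c m y = c m z} = \<kappa> m" if z: "z \<in> insert x P" for z
  proof (cases "z = x")
    case True
    then show ?thesis using m0 sum'[of m0 "c m0 x"] by (intro exI[of _ m0]) (simp add: slack_def)
  next
    case False
    then obtain m where m: "m \<le> N" "sum \<nu> {y \<in> P. c m y = c m z} = \<kappa> m"
      using \<nu>(3)[of z] z by auto
    \<comment> \<open>Older saturated cells stay saturated, since masses only grow and remain
      capped.\<close>
    have "sum \<nu>' {y \<in> insert x P. c m y = c m z} \<ge> \<kappa> m"
      unfolding sum' using m s0 by simp
    then show ?thesis using cap[OF m(1)] m(1) by (meson antisym)
  qed
  moreover have "0 \<le> \<nu>' y" for y using \<nu>(1) s0 by (simp add: \<nu>'_def)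
  ultimately show ?case using cap by (intro exI[of _ \<nu>']) blast
qed

text \<open>Each point selects its coarsest saturated cell. Distinct selected cells are disjoint by
  nestedness, so their caps, being their masses, sum to at most the total mass.\<close>

lemma saturated_cells_cover:
  fixes c :: "nat \<Rightarrow> 'a \<Rightarrow> 'b" and \<kappa> \<nu>
  assumes "finite P" "\<And>x. 0 \<le> \<nu> x"
    and nested: "\<And>m n x y. m \<le> n \<Longrightarrow> c n x = c n y \<Longrightarrow> c m x = c m y"
    and sat: "\<And>x. x \<in> P \<Longrightarrow> \<exists>m\<le>N. sum \<nu> {y \<in> P. c m y = c m x} = \<kappa> m"
  shows "\<exists>Q. finite Q \<and> (\<forall>(m, q)\<in>Q. m \<le> N) \<and> (\<forall>x\<in>P. \<exists>(m, q)\<in>Q. c m x = q) \<and>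
           (\<Sum>(m, q)\<in>Q. \<kappa> m) \<le> (sum \<nu> P :: real)"
proof -
  define S where "S m x \<longleftrightarrow> m \<le> N \<and> sum \<nu> {y \<in> P. c m y = c m x} = \<kappa> m" for m x
  define \<mu> where "\<mu> x = (LEAST m. S m x)" for x
  have \<mu>: "S (\<mu> x) x" if "x \<in> P" for x
  proof -
    have "\<exists>m. S m x" using sat[OF that] unfolding S_def .
    then show ?thesis unfolding \<mu>_def by (rule LeastI_ex)
  qed
  have \<mu>_le: "\<mu> x \<le> m" if "S m x" for m x
    unfolding \<mu>_def using that by (rule Least_le)
  define Q where "Q = (\<lambda>x. (\<mu> x, c (\<mu> x) x)) ` P"
  define cell where "cell = (\<lambda>(m, q). {x \<in> P. c m x = q})"
  \<comment> \<open>If two selected cells share \<open>z\<close>, the finer one lies inside the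
    coarser one; the latter is then a saturated cell of \<open>y\<close> too, and minimality forces
    equal levels.\<close>
  have mono: "\<mu> y \<le> \<mu> x" if "x \<in> P" "z \<in> P" "c (\<mu> x) z = c (\<mu> x) x" "c (\<mu> y) z = c (\<mu> y) y" "\<mu> x \<le> \<mu> y" for x y z
  proof -
    have "c (\<mu> x) y = c (\<mu> x) x" using nested[OF that(5,4)] that(3) by simp
    then have "S (\<mu> x) y" using \<mu>[OF that(1)] by (simp add: S_def)
    then show ?thesis by (rule \<mu>_le)
  qed
  have disj: "cell i \<inter> cell j = {}" if ij: "i \<in> Q" "j \<in> Q" "i \<noteq> j" for i j
  proof (rule ccontr)
    assume "cell i \<inter> cell j \<noteq> {}"
    moreover obtain x y where xy: "x \<in> P" "y \<in> P" "i = (\<mu> x, c (\<mu> x) x)" "j = (\<mu> y, c (\<mu> y) y)"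
      using ij by (auto simp: Q_def)
    ultimately obtain z where z: "z \<in> P" "c (\<mu> x) z = c (\<mu> x) x" "c (\<mu> y) z = c (\<mu> y) y"
      by (auto simp: cell_def)
    have "\<mu> x = \<mu> y"
      using mono[of x z y] mono[of y z x] xy z by (metis antisym nat_le_linear)
    then show False using xy z ij(3) by auto
  qed
  have "(\<Sum>(m, q)\<in>Q. \<kappa> m) = (\<Sum>i\<in>Q. sum \<nu> (cell i))"
    using \<mu> by (intro sum.cong) (auto simp: Q_def cell_def S_def)
  also have "\<dots> = sum \<nu> (\<Union>i\<in>Q. cell i)"
    using assms(1) disj by (intro sum.UNION_disjoint[symmetric]) (auto simp: Q_def cell_def)
  also have "\<dots> \<le> sum \<nu> P"
    using assms by (intro sum_mono2) (auto simp: cell_def)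
  finally have "(\<Sum>(m, q)\<in>Q. \<kappa> m) \<le> sum \<nu> P" .
  then show ?thesis
    using assms(1) \<mu> by (intro exI[of _ Q]) (auto simp: Q_def S_def)
qed

text \<open>Points of the graph are represented by their first coordinate.\<close>

definition dyadic_cell :: "(real \<Rightarrow> real) \<Rightarrow> nat \<Rightarrow> real \<Rightarrow> int \<times> int" where
  "dyadic_cell f m x = (\<lfloor>2 ^ m * x\<rfloor>, \<lfloor>2 ^ m * f x\<rfloor>)"

text \<open>The l1 distance of the graph points over \<open>x\<close> and \<open>y\<close>,
  truncated at the resolution \<open>(1/2) ^ N\<close> so that the energy kernel stays finite on the
  diagonal.\<close>

definition coarse_dist :: "(real \<Rightarrow> real) \<Rightarrow> nat \<Rightarrow> real \<Rightarrow> real \<Rightarrow> real" where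
  "coarse_dist f N x y = max (\<bar>x - y\<bar> + \<bar>f x - f y\<bar>) ((1/2) ^ N)"

lemma coarse_dist_pos: "0 < coarse_dist f N x y"
  unfolding coarse_dist_def by (simp add: less_max_iff_disj)

section \<open>Dyadic cells and covers of the graph\<close>

lemma dyadic_cell_nested:
  assumes "m \<le> n" "dyadic_cell f n x = dyadic_cell f n y"
  shows "dyadic_cell f m x = dyadic_cell f m y"
proof -
  obtain k where n: "n = m + k" using assms(1) le_Suc_ex by blast
  have "\<lfloor>2 ^ m * z\<rfloor> = \<lfloor>2 ^ n * z\<rfloor> div 2 ^ k" for z :: real
  proof -
    have "2 ^ m * z = 2 ^ n * z / real_of_int (2 ^ k)"
      by (simp add: n power_add)
    then show ?thesis by (simp only: floor_divide_real_eq_div zero_le_power zero_le_numeral)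
  qed
  then show ?thesis using assms(2) by (simp add: dyadic_cell_def)
qed

lemma abs_diff_le_of_floor_eq:
  assumes "\<lfloor>2 ^ m * x\<rfloor> = \<lfloor>2 ^ m * (y::real)\<rfloor>"
  shows "\<bar>x - y\<bar> \<le> (1/2) ^ m"
proof -
  have "\<bar>2 ^ m * x - 2 ^ m * y\<bar> \<le> 1" using assms by linarith
  then have "2 ^ m * \<bar>x - y\<bar> \<le> 1"
    by (simp add: abs_mult flip: right_diff_distrib)
  then show ?thesis by (simp add: field_simps power_one_over)
qed

lemma abs_floor_diff_le:
  assumes "\<bar>x - y\<bar> \<le> (1/2) ^ m"
  shows "\<bar>\<lfloor>2 ^ m * x\<rfloor> - \<lfloor>2 ^ m * (y::real)\<rfloor>\<bar> \<le> 1"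
proof -
  have "2 ^ m * \<bar>x - y\<bar> \<le> 1" using assms by (simp add: field_simps power_one_over)
  then have "\<bar>2 ^ m * x - 2 ^ m * y\<bar> \<le> 1"
    by (simp add: abs_mult flip: right_diff_distrib)
  then show ?thesis by linarith
qed

lemma finite_dyadic_cells:
  assumes "bounded K" "bounded (f ` K)"
  shows "finite (dyadic_cell f m ` K)"
proof -
  have fin: "finite ((\<lambda>x. \<lfloor>2 ^ m * x\<rfloor>) ` A)" if A: "bounded A" for A :: "real set"
  proof -
    obtain B where "\<And>x. x \<in> A \<Longrightarrow> \<bar>x\<bar> \<le> B" using A unfolding bounded_iff by auto
    then have "2 ^ m * (-B) \<le> 2 ^ m * x \<and> 2 ^ m * x \<le> 2 ^ m * B" if "x \<in> A" for x
      using that by (intro conjI mult_left_mono) (force simp: abs_le_iff minus_le_iff)+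
    then have "\<lfloor>2 ^ m * x\<rfloor> \<in> {\<lfloor>2 ^ m * (-B)\<rfloor>..\<lfloor>2 ^ m * B\<rfloor>}" if "x \<in> A" for x
      using that unfolding atLeastAtMost_iff by (intro conjI floor_mono) blast+
    then show ?thesis by (intro finite_subset[OF _ finite_atLeastAtMost_int]) blast
  qed
  have "dyadic_cell f m ` K \<subseteq> ((\<lambda>x. \<lfloor>2 ^ m * x\<rfloor>) ` K) \<times> ((\<lambda>x. \<lfloor>2 ^ m * x\<rfloor>) ` (f ` K))"
    by (auto simp: dyadic_cell_def)
  then show ?thesis using fin assms by (meson finite_SigmaI finite_subset)
qed

text \<open>Some pair \<open>\<delta>\<close>, \<open>\<epsilon>\<close> excludes every cheap cover
  by sets of diameter at most \<open>\<delta>\<close>. Small cells form such a cover, and a single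
  large cell already contributes a fixed amount.\<close>

lemma dyadic_cover_lower_bound:
  assumes "hausdorff_measure t (graph_on K f) \<noteq> 0" "0 \<le> t"
  shows "\<exists>c>0. \<forall>Q. finite Q \<longrightarrow> (\<forall>x\<in>K. \<exists>(m, q)\<in>Q. dyadic_cell f m x = q) \<longrightarrow>
           c \<le> (\<Sum>(m, q)\<in>Q. ((1/2) ^ m) powr t)"
proof -
  obtain \<delta> \<epsilon> :: real where pos: "\<delta> > 0" "\<epsilon> > 0"
    and no: "\<And>U. graph_on K f \<subseteq> (\<Union>i::nat. U i) \<Longrightarrow>
      (\<forall>i. bounded (U i) \<and> diameter (U i) \<le> \<delta>) \<Longrightarrow>
      \<not> (\<Sum>i. ennreal (diameter (U i) powr t)) < ennreal \<epsilon>"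
    using assms(1) hausdorff_measure_nullI[of "graph_on K f" t] by metis
  \<comment> \<open>The first entry serves covers by small cells, whose diameters are at most
    \<open>2 * (1/2) ^ m\<close>; the second is the contribution of one large cell.\<close>
  define c where "c = min (\<epsilon> / 2 powr t) ((\<delta> / 2) powr t)"
  have "c > 0" using pos by (simp add: c_def)
  moreover have "c \<le> (\<Sum>(m, q)\<in>Q. ((1/2) ^ m) powr t)"
    if "finite Q" and cov: "\<forall>x\<in>K. \<exists>(m, q)\<in>Q. dyadic_cell f m x = q" for Q
  proof (cases "\<forall>(m, q)\<in>Q. 2 * (1/2) ^ m \<le> \<delta>")
    case True
    obtain l where l: "set l = Q" "distinct l" using \<open>finite Q\<close> finite_distinct_list by blast
    define cell where "cell = (\<lambda>(m, q). {(x, f x) | x. x \<in> K \<and> dyadic_cell f m x = q})"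
    \<comment> \<open>The finite cover is padded with empty sets, whose terms
      \<open>0 powr t\<close> vanish even for \<open>t = 0\<close>.\<close>
    define U where "U i = (if i < length l then cell (l ! i) else {})" for i
    have diam: "bounded (cell (m, q)) \<and> diameter (cell (m, q)) \<le> 2 * (1/2) ^ m" for m q
    proof -
      have "dist p p' \<le> 2 * (1/2) ^ m" if p: "p \<in> cell (m, q)" "p' \<in> cell (m, q)" for p p'
      proof -
        obtain x where x: "p = (x, f x)" "dyadic_cell f m x = q"
          using p(1) by (auto simp: cell_def)
        obtain y where y: "p' = (y, f y)" "dyadic_cell f m y = q"
          using p(2) by (auto simp: cell_def)
        have "dist p p' \<le> \<bar>x - y\<bar> + \<bar>f x - f y\<bar>"
          unfolding x y dist_Pair_Pair dist_real_def by (rule sqrt_sum_squares_le_sum_abs[THEN order_trans]) simp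
        also have "\<dots> \<le> (1/2) ^ m + (1/2) ^ m"
          using x(2) y(2) by (intro add_mono abs_diff_le_of_floor_eq) (auto simp: dyadic_cell_def)
        finally show ?thesis by simp
      qed
      then show ?thesis
        unfolding bounded_two_points by (intro conjI exI ballI diameter_le) (auto simp: dist_norm)
    qed
    have sub: "graph_on K f \<subseteq> (\<Union>i. U i)"
    proof
      fix p assume "p \<in> graph_on K f"
      then obtain x where x: "x \<in> K" "p = (x, f x)" by (auto simp: graph_on_def)
      then obtain m q where "(m, q) \<in> Q" "dyadic_cell f m x = q" using cov by auto
      then obtain i where "i < length l" "l ! i = (m, q)" using l by (auto simp: in_set_conv_nth)
      then have "p \<in> U i" using x \<open>dyadic_cell f m x = q\<close> by (auto simp: U_def cell_def)
      then show "p \<in> (\<Union>i. U i)" by blast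
    qed
    have small: "bounded (U i) \<and> diameter (U i) \<le> \<delta>" for i
    proof (cases "i < length l")
      case i: True
      obtain m q where mq: "l ! i = (m, q)" by (cases "l ! i")
      then have "2 * (1/2) ^ m \<le> \<delta>" using True i l(1) nth_mem by fastforce
      then show ?thesis using diam[of m q] i mq by (auto simp: U_def)
    qed (use pos in \<open>auto simp: U_def\<close>)
    have "ennreal \<epsilon> \<le> (\<Sum>i. ennreal (diameter (U i) powr t))"
      using no[OF sub] small by (meson not_less)
    also have "\<dots> = (\<Sum>i<length l. ennreal (diameter (cell (l ! i)) powr t))"
      by (subst suminf_finite[of "{..<length l}"]) (auto simp: U_def)
    also have "\<dots> = (\<Sum>i\<in>Q. ennreal (diameter (cell i) powr t))"
      using l by (intro sum.reindex_bij_betw bij_betw_nth) auto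
    also have "\<dots> \<le> (\<Sum>(m, q)\<in>Q. ennreal (2 powr t * ((1/2) ^ m) powr t))"
    proof (intro sum_mono, clarify)
      fix m q
      have "diameter (cell (m, q)) powr t \<le> (2 * (1/2) ^ m) powr t"
        using diam[of m q] assms(2) by (intro powr_mono2 diameter_ge_0) auto
      then show "ennreal (diameter (cell (m, q)) powr t) \<le> ennreal (2 powr t * ((1/2) ^ m) powr t)"
        by (simp only: powr_mult ennreal_leI)
    qed
    also have "\<dots> = ennreal (2 powr t * (\<Sum>(m, q)\<in>Q. ((1/2) ^ m) powr t))"
      by (simp add: sum_distrib_left case_prod_unfold sum_nonneg flip: sum_ennreal)
    finally have "\<epsilon> \<le> 2 powr t * (\<Sum>(m, q)\<in>Q. ((1/2) ^ m) powr t)"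
      by (subst (asm) ennreal_le_iff) (auto intro!: mult_nonneg_nonneg sum_nonneg)
    then show ?thesis by (simp add: c_def field_simps min_le_iff_disj)
  next
    case False
    then obtain m q where mq: "(m, q) \<in> Q" "\<delta> < 2 * (1/2) ^ m" by (auto simp: not_le)
    have "c \<le> (\<delta> / 2) powr t" by (simp add: c_def)
    also have "\<dots> \<le> ((1/2) ^ m) powr t" using pos mq assms(2) by (intro powr_mono2) auto
    also have "\<dots> \<le> (\<Sum>(m, q)\<in>Q. ((1/2) ^ m) powr t)"
      using member_le_sum[OF mq(1), of "\<lambda>(m, q). ((1/2) ^ m) powr t"] \<open>finite Q\<close> by auto
    finally show ?thesis .
  qed
  ultimately show ?thesis by blast
qed

section \<open>From capped cells to bounded energy\<close>

lemma card_centered_int_pairs: "card ({i - 1..i + 1} \<times> {j - 1..j + 1} :: (int \<times> int) set) = 9"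
  by (simp add: card_cartesian_product)

text \<open>Points this close to the graph point over \<open>x\<close> lie in the nine squares
  around its own, which turns caps on cells into caps on balls.\<close>

lemma sum_near_le:
  assumes "finite P" "\<And>x. 0 \<le> \<nu> x" "\<And>q. sum \<nu> {y \<in> P. dyadic_cell f m y = q} \<le> \<kappa>"
  shows "sum \<nu> {y \<in> P. \<bar>x - y\<bar> + \<bar>f x - f y\<bar> \<le> (1/2) ^ m} \<le> (9 * \<kappa> :: real)"
proof -
  define i j where "i = \<lfloor>2 ^ m * x\<rfloor>" and "j = \<lfloor>2 ^ m * f x\<rfloor>"
  define Z where "Z = {i - 1..i + 1} \<times> {j - 1..j + 1}"
  define S where "S = {y \<in> P. dyadic_cell f m y \<in> Z}"
  have "{y \<in> P. \<bar>x - y\<bar> + \<bar>f x - f y\<bar> \<le> (1/2) ^ m} \<subseteq> S"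
  proof
    fix y assume y: "y \<in> {y \<in> P. \<bar>x - y\<bar> + \<bar>f x - f y\<bar> \<le> (1/2) ^ m}"
    then have "\<bar>x - y\<bar> \<le> (1/2) ^ m" "\<bar>f x - f y\<bar> \<le> (1/2) ^ m" by auto
    from abs_floor_diff_le[OF this(1)] abs_floor_diff_le[OF this(2)]
    show "y \<in> S" using y by (auto simp: S_def Z_def dyadic_cell_def i_def j_def)
  qed
  then have "sum \<nu> {y \<in> P. \<bar>x - y\<bar> + \<bar>f x - f y\<bar> \<le> (1/2) ^ m} \<le> sum \<nu> S"
    using assms by (intro sum_mono2) (auto simp: S_def)
  also have "\<dots> = (\<Sum>q\<in>Z. sum \<nu> {y \<in> S. dyadic_cell f m y = q})"
    using assms(1) by (intro sum.group[symmetric]) (auto simp: S_def Z_def)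
  also have "\<dots> \<le> (\<Sum>q\<in>Z. \<kappa>)"
  proof (rule sum_mono)
    fix q assume "q \<in> Z"
    then have "{y \<in> S. dyadic_cell f m y = q} = {y \<in> P. dyadic_cell f m y = q}"
      by (auto simp: S_def)
    then show "sum \<nu> {y \<in> S. dyadic_cell f m y = q} \<le> \<kappa>" using assms(3) by simp
  qed
  also have "\<dots> = 9 * \<kappa>" unfolding Z_def sum_constant card_centered_int_pairs by simp
  finally show ?thesis .
qed

text \<open>Dyadic decomposition of the kernel: the term of the level matching the distance
  suffices, \<open>2 powr t\<close> bridges consecutive scales, and the summand 1 covers distances
  of at least 1.\<close>

lemma coarse_dist_powr_le:
  assumes "0 \<le> t"
  shows "coarse_dist f N x y powr - t \<le>
    1 + (\<Sum>m\<le>N. 2 powr t * ((1/2) ^ m) powr - t * of_bool (\<bar>x - y\<bar> + \<bar>f x - f y\<bar> \<le> (1/2) ^ m))"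
    (is "_ \<le> 1 + sum ?a _")
proof -
  let ?D = "coarse_dist f N x y"
  have a0: "0 \<le> ?a m" for m by simp
  then have s0: "0 \<le> (\<Sum>m\<le>N. ?a m)" by (rule sum_nonneg)
  show ?thesis
  proof (cases "?D \<ge> 1")
    case True
    then have "?D powr - t \<le> ?D powr 0" using assms by (intro powr_mono) auto
    then show ?thesis using True s0 by simp
  next
    case False
    \<comment> \<open>The level \<open>m\<close> satisfies \<open>(1/2) ^ Suc m \<le> ?D\<close> and
      \<open>?D \<le> (1/2) ^ m\<close>; the truncation of the distance keeps it at most
      \<open>N\<close>.\<close>
    define R where "R k \<longleftrightarrow> (1/2) ^ Suc k \<le> ?D" for k
    define m where "m = (LEAST k. R k)"
    have "(1/2::real) ^ Suc N \<le> (1/2) ^ N" by simp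
    then have N: "R N" unfolding R_def coarse_dist_def by linarith
    have m1: "(1/2) ^ Suc m \<le> ?D" using LeastI[of R, OF N] unfolding m_def R_def .
    have mN: "m \<le> N" unfolding m_def by (rule Least_le[of R, OF N])
    have m2: "?D \<le> (1/2) ^ m"
    proof (cases m)
      case 0
      then show ?thesis using False by simp
    next
      case (Suc k)
      then have "k < m" by simp
      then have "\<not> R k" unfolding m_def by (rule not_less_Least)
      then show ?thesis using Suc by (simp add: R_def)
    qed
    have "?D powr - t \<le> ((1/2) ^ Suc m) powr - t"
      using m1 assms by (intro powr_mono2') auto
    also have "\<dots> = (1/2) powr - t * ((1/2) ^ m) powr - t"
      unfolding power_Suc by (rule powr_mult)
    also have "\<dots> = ?a m"
      using m2 by (simp add: coarse_dist_def powr_minus powr_divide)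
    also have "\<dots> \<le> (\<Sum>m\<le>N. ?a m)"
      using mN by (intro member_le_sum a0) auto
    finally show ?thesis by simp
  qed
qed

text \<open>Greedy weights with caps \<open>((1/2) ^ m) powr t\<close> have mass bounded below,
  because their saturated cells cover the graph. Their potentials of exponent \<open>t'\<close> are
  bounded by a geometric series of ratio \<open>(1/2) powr (t - t')\<close>, uniformly in
  \<open>N\<close>.\<close>

lemma discrete_frostman:
  fixes K :: "real set" and f :: "real \<Rightarrow> real"
  assumes "bounded K" "bounded (f ` K)" "hausdorff_measure t (graph_on K f) \<noteq> 0"
    and "0 \<le> t'" "t' < t"
  shows "\<exists>c>0. \<exists>E. \<forall>N. \<exists>P \<nu>. finite P \<and> P \<subseteq> K \<and> (\<forall>x. 0 \<le> \<nu> x) \<and> c \<le> sum \<nu> P \<and>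
           (\<Sum>x\<in>P. \<Sum>y\<in>P. \<nu> x * \<nu> y * coarse_dist f N x y powr - t') \<le> E"
proof -
  let ?c = "dyadic_cell f"
  define \<kappa> :: "nat \<Rightarrow> real" where "\<kappa> m = ((1/2) ^ m) powr t" for m
  obtain c where c: "c > 0" "\<And>Q. finite Q \<Longrightarrow> (\<forall>x\<in>K. \<exists>(m, q)\<in>Q. ?c m x = q) \<Longrightarrow>
      c \<le> (\<Sum>(m, q)\<in>Q. \<kappa> m)"
    using dyadic_cover_lower_bound[OF assms(3)] assms(4,5) unfolding \<kappa>_def by auto
  \<comment> \<open>Bounds the total mass: each cell of level 0 carries at most
    \<open>\<kappa> 0 = 1\<close>.\<close>
  define T where "T = real (card (?c 0 ` K))"
  define r where "r = (1/2) powr (t - t')"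
  have r: "0 < r" "r < 1" using gr_one_powr[of 2 "t - t'"] assms(5) by (auto simp: r_def powr_divide)
  define B where "B = 1 * T + 2 powr t' * 9 * (1 / (1 - r))"
  have "\<exists>P \<nu>. finite P \<and> P \<subseteq> K \<and> (\<forall>x. 0 \<le> \<nu> x) \<and> c \<le> sum \<nu> P \<and>
           (\<Sum>x\<in>P. \<Sum>y\<in>P. \<nu> x * \<nu> y * coarse_dist f N x y powr - t') \<le> T * B" for N
  proof -
    \<comment> \<open>One representative per cell of level \<open>N\<close>: by nestedness, cells of
      level at most \<open>N\<close> covering the representatives cover all of
      \<open>K\<close>.\<close>
    define P where "P = inv_into K (?c N) ` (?c N ` K)"
    have P: "finite P" "P \<subseteq> K"
      using finite_dyadic_cells[OF assms(1,2)] by (auto simp: P_def inv_into_into)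
    have rep: "\<exists>y\<in>P. ?c N y = ?c N x" if "x \<in> K" for x
      using that unfolding P_def by (auto simp: f_inv_into_f)
    have \<kappa>0: "0 \<le> \<kappa> m" for m by (simp add: \<kappa>_def)
    from greedy_weights[of P \<kappa> N ?c, OF P(1) \<kappa>0] obtain \<nu> where greedy:
      "(\<forall>x. 0 \<le> \<nu> x) \<and> (\<forall>m\<le>N. \<forall>q. sum \<nu> {x \<in> P. ?c m x = q} \<le> \<kappa> m) \<and>
       (\<forall>x\<in>P. \<exists>m\<le>N. sum \<nu> {y \<in> P. ?c m y = ?c m x} = \<kappa> m)" ..
    have \<nu>: "\<forall>x. 0 \<le> \<nu> x" using greedy by blast
    have cap: "sum \<nu> {x \<in> P. ?c m x = q} \<le> \<kappa> m" if "m \<le> N" for m q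
      using greedy that by blast
    have "\<exists>Q. finite Q \<and> (\<forall>(m, q)\<in>Q. m \<le> N) \<and> (\<forall>x\<in>P. \<exists>(m, q)\<in>Q. ?c m x = q) \<and>
        (\<Sum>(m, q)\<in>Q. \<kappa> m) \<le> sum \<nu> P"
      using P(1) greedy by (intro saturated_cells_cover) (auto intro: dyadic_cell_nested)
    then obtain Q where Q: "finite Q" "\<forall>(m, q)\<in>Q. m \<le> N" "\<forall>x\<in>P. \<exists>(m, q)\<in>Q. ?c m x = q"
      "(\<Sum>(m, q)\<in>Q. \<kappa> m) \<le> sum \<nu> P" by blast
    have "\<forall>x\<in>K. \<exists>(m, q)\<in>Q. ?c m x = q"
    proof
      fix x assume "x \<in> K"
      then obtain y where y: "y \<in> P" "?c N y = ?c N x" using rep by blast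
      then obtain m q where "(m, q) \<in> Q" "?c m y = q" using Q(3) by auto
      moreover have "?c m y = ?c m x" using dyadic_cell_nested[OF _ y(2)] Q(2) calculation by auto
      ultimately show "\<exists>(m, q)\<in>Q. ?c m x = q" by auto
    qed
    then have mass: "c \<le> sum \<nu> P" using c(2)[OF Q(1)] Q(4) by linarith
    have "sum \<nu> P = (\<Sum>q\<in>?c 0 ` K. sum \<nu> {x \<in> P. ?c 0 x = q})"
      using P finite_dyadic_cells[OF assms(1,2)] by (intro sum.group[symmetric]) auto
    also have "\<dots> \<le> (\<Sum>q\<in>?c 0 ` K. 1)"
      using cap[of 0] by (intro sum_mono) (simp add: \<kappa>_def)
    finally have total: "sum \<nu> P \<le> T" by (simp add: T_def)
    have near: "sum \<nu> {y \<in> P. \<bar>x - y\<bar> + \<bar>f x - f y\<bar> \<le> (1/2) ^ m} \<le> 9 * \<kappa> m" if "m \<le> N" for x m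
      using P(1) \<nu> cap[OF that] by (intro sum_near_le) auto
    have geo: "(\<Sum>m\<le>N. r ^ m) \<le> 1 / (1 - r)"
      using sum_le_suminf[of "\<lambda>m. r ^ m" "{..N}"] r by (simp add: suminf_geometric summable_geometric)
    have inner: "(\<Sum>y\<in>P. \<nu> y * coarse_dist f N x y powr - t') \<le> B" for x
    proof -
      let ?near = "\<lambda>m y. of_bool (\<bar>x - y\<bar> + \<bar>f x - f y\<bar> \<le> (1/2) ^ m) :: real"
      have "(\<Sum>y\<in>P. \<nu> y * coarse_dist f N x y powr - t') \<le>
          (\<Sum>y\<in>P. \<nu> y * (1 + (\<Sum>m\<le>N. 2 powr t' * ((1/2) ^ m) powr - t' * ?near m y)))"
        using \<nu> assms(4) by (intro sum_mono mult_left_mono coarse_dist_powr_le) auto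
      also have "\<dots> = sum \<nu> P + (\<Sum>y\<in>P. \<Sum>m\<le>N. 2 powr t' * ((1/2) ^ m) powr - t' * (\<nu> y * ?near m y))"
        by (simp add: ring_distribs sum.distrib sum_distrib_left mult_ac)
      also have "(\<Sum>y\<in>P. \<Sum>m\<le>N. 2 powr t' * ((1/2) ^ m) powr - t' * (\<nu> y * ?near m y)) =
          (\<Sum>m\<le>N. 2 powr t' * ((1/2) ^ m) powr - t' * (\<Sum>y\<in>P. \<nu> y * ?near m y))"
        by (subst sum.swap) (simp add: sum_distrib_left)
      also have "\<dots> \<le> (\<Sum>m\<le>N. 2 powr t' * ((1/2) ^ m) powr - t' * (9 * \<kappa> m))"
      proof (intro sum_mono mult_left_mono)
        fix m assume "m \<in> {..N}"
        have "(\<Sum>y\<in>P. \<nu> y * ?near m y) = sum \<nu> {y \<in> P. \<bar>x - y\<bar> + \<bar>f x - f y\<bar> \<le> (1/2) ^ m}"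
          using P(1) by (simp add: sum.inter_filter of_bool_def if_distrib cong: if_cong)
        then show "(\<Sum>y\<in>P. \<nu> y * ?near m y) \<le> 9 * \<kappa> m" using near \<open>m \<in> {..N}\<close> by simp
      qed auto
      also have "\<dots> = 2 powr t' * 9 * (\<Sum>m\<le>N. r ^ m)"
      proof -
        have "((1/2) ^ m) powr - t' * \<kappa> m = r ^ m" for m
        proof -
          have "((1/2::real) ^ m) powr - t' * \<kappa> m = ((1/2) ^ m) powr (t - t')"
            unfolding \<kappa>_def powr_add[symmetric] by simp
          also have "\<dots> = r ^ m"
            by (simp add: r_def powr_powr powr_realpow[symmetric] mult.commute)
          finally show ?thesis .
        qed
        then have "2 powr t' * ((1/2) ^ m) powr - t' * (9 * \<kappa> m) = 2 powr t' * 9 * r ^ m" for m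
          by (simp only: mult.assoc mult.left_commute[of _ 9])
        then show ?thesis unfolding sum_distrib_left by (simp only:)
      qed
      also have "\<dots> \<le> 2 powr t' * 9 * (1 / (1 - r))"
        using geo by (intro mult_left_mono) auto
      finally show ?thesis using total by (simp add: B_def)
    qed
    have B0: "0 \<le> B" using r by (auto simp: B_def T_def intro!: add_nonneg_nonneg)
    have "(\<Sum>x\<in>P. \<Sum>y\<in>P. \<nu> x * \<nu> y * coarse_dist f N x y powr - t') =
        (\<Sum>x\<in>P. \<nu> x * (\<Sum>y\<in>P. \<nu> y * coarse_dist f N x y powr - t'))"
      by (simp add: sum_distrib_left mult.assoc)
    also have "\<dots> \<le> (\<Sum>x\<in>P. \<nu> x * B)"
      using \<nu> inner by (intro sum_mono mult_left_mono) auto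
    also have "\<dots> = sum \<nu> P * B" by (simp add: sum_distrib_right)
    also have "\<dots> \<le> T * B" using total B0 by (intro mult_right_mono)
    finally show ?thesis using P \<nu> mass by blast
  qed
  then show ?thesis using c(1) by blast
qed

subsection \<open>Energy of weights near a line\<close>

text \<open>The energy dominates the contribution of pairs within one group, which is at least the
  sum of \<open>(W i)\<^sup>2 / \<kappa> i\<close>; Cauchy-Schwarz compares this with the squared
  mass. It is the discrete form of bounding capacity by Hausdorff content.\<close>

lemma square_sum_le_energy:
  fixes w :: "'a \<Rightarrow> real"
  assumes "finite P" "finite I" "\<And>x. x \<in> P \<Longrightarrow> g x \<in> I" "\<And>x. 0 \<le> w x" "\<And>x y. 0 \<le> k x y"
    and "\<And>i. i \<in> I \<Longrightarrow> 0 < \<kappa> i"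
    and k: "\<And>x y. x \<in> P \<Longrightarrow> y \<in> P \<Longrightarrow> g x = g y \<Longrightarrow> 1 / \<kappa> (g x) \<le> k x y"
  shows "(sum w P)\<^sup>2 \<le> (\<Sum>x\<in>P. \<Sum>y\<in>P. w x * w y * k x y) * sum \<kappa> I"
proof -
  define W where "W i = sum w {x \<in> P. g x = i}" for i
  have "sum w P = (\<Sum>i\<in>I. W i)"
    unfolding W_def using assms by (intro sum.group[symmetric]) auto
  also have "\<dots> = (\<Sum>i\<in>I. (W i / sqrt (\<kappa> i)) * sqrt (\<kappa> i))"
    using assms(6) by (intro sum.cong) (auto simp: less_le)
  finally have "(sum w P)\<^sup>2 \<le> (\<Sum>i\<in>I. (W i / sqrt (\<kappa> i))\<^sup>2) * (\<Sum>i\<in>I. (sqrt (\<kappa> i))\<^sup>2)"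
    using Cauchy_Schwarz_ineq_sum[of "\<lambda>i. W i / sqrt (\<kappa> i)" "\<lambda>i. sqrt (\<kappa> i)" I] by simp
  also have "(\<Sum>i\<in>I. (sqrt (\<kappa> i))\<^sup>2) = sum \<kappa> I"
    using assms(6) by (intro sum.cong) (auto simp: less_imp_le)
  also have "(\<Sum>i\<in>I. (W i / sqrt (\<kappa> i))\<^sup>2) * sum \<kappa> I \<le> (\<Sum>x\<in>P. \<Sum>y\<in>P. w x * w y * k x y) * sum \<kappa> I"
  proof (rule mult_right_mono)
    have "(\<Sum>i\<in>I. (W i / sqrt (\<kappa> i))\<^sup>2) = (\<Sum>i\<in>I. \<Sum>x\<in>{x \<in> P. g x = i}. w x * W (g x) / \<kappa> (g x))"
    proof (rule sum.cong[OF refl])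
      fix i assume "i \<in> I"
      then have "(W i / sqrt (\<kappa> i))\<^sup>2 = W i * (W i / \<kappa> i)"
        using assms(6)[of i] by (simp add: power_divide power2_eq_square[of "W i"] less_imp_le)
      also have "\<dots> = (\<Sum>x\<in>{x \<in> P. g x = i}. w x * (W i / \<kappa> i))"
        unfolding sum_distrib_right[symmetric] by (simp add: W_def)
      also have "\<dots> = (\<Sum>x\<in>{x \<in> P. g x = i}. w x * W (g x) / \<kappa> (g x))"
        by (intro sum.cong) auto
      finally show "(W i / sqrt (\<kappa> i))\<^sup>2 = \<dots>" .
    qed
    also have "\<dots> = (\<Sum>x\<in>P. w x * W (g x) / \<kappa> (g x))"
      using assms(1-3) by (intro sum.group) auto
    also have "\<dots> \<le> (\<Sum>x\<in>P. \<Sum>y\<in>P. w x * w y * k x y)"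
    proof (rule sum_mono)
      fix x assume "x \<in> P"
      have "w x * W (g x) / \<kappa> (g x) = (\<Sum>y\<in>{y \<in> P. g y = g x}. w x * w y * (1 / \<kappa> (g x)))"
        by (simp add: W_def sum_distrib_left sum_divide_distrib)
      also have "\<dots> \<le> (\<Sum>y\<in>{y \<in> P. g y = g x}. w x * w y * k x y)"
        using \<open>x \<in> P\<close> by (intro sum_mono mult_left_mono k mult_nonneg_nonneg assms(4)) auto
      also have "\<dots> \<le> (\<Sum>y\<in>P. w x * w y * k x y)"
        using assms(1,4,5) by (intro sum_mono2) auto
      finally show "w x * W (g x) / \<kappa> (g x) \<le> \<dots>" .
    qed
    finally show "(\<Sum>i\<in>I. (W i / sqrt (\<kappa> i))\<^sup>2) \<le> (\<Sum>x\<in>P. \<Sum>y\<in>P. w x * w y * k x y)" .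
  qed (use assms(6) in \<open>auto intro!: sum_nonneg simp: less_imp_le\<close>)
  finally show ?thesis .
qed

text \<open>Every set of a cheap cover is enlarged to an open ball at a summable extra cost;
  compactness then leaves finitely many balls.\<close>

lemma hausdorff_null_finite_ball_cover:
  fixes F :: "'a::metric_space set"
  assumes "compact F" "hausdorff_measure u F = 0" "0 < u" "0 < \<epsilon>"
  shows "\<exists>(I :: nat set) c l. finite I \<and> (\<forall>i\<in>I. 0 < l i) \<and> F \<subseteq> (\<Union>i\<in>I. ball (c i) (l i)) \<and>
           (\<Sum>i\<in>I. l i powr u) \<le> \<epsilon>"
proof -
  have "(0::real) < 1" "0 < \<epsilon> / 2" using assms(4) by auto
  from hausdorff_measure_nullE[OF assms(2) this]
  obtain U :: "nat \<Rightarrow> 'a set" where U: "F \<subseteq> (\<Union>i. U i)" "\<And>i. bounded (U i)"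
    "(\<Sum>i. ennreal (diameter (U i) powr u)) < ennreal (\<epsilon> / 2)" by metis
  define e :: "nat \<Rightarrow> real" where "e i = \<epsilon> / 2 * (1/2) ^ Suc i" for i
  have e: "0 < e i" for i using assms(4) by (simp add: e_def)
  \<comment> \<open>Chosen so that \<open>l i powr u\<close> exceeds the term of \<open>U i\<close>
    by exactly \<open>e i\<close>; the radius is thus positive even for sets of diameter 0.\<close>
  define l where "l i = (diameter (U i) powr u + e i) powr (1 / u)" for i
  define c where "c i = (SOME x. x \<in> U i)" for i
  have lu: "l i powr u = diameter (U i) powr u + e i" for i
    using e[of i] assms(3) by (simp add: l_def powr_powr add_nonneg_pos less_imp_le)
  have l0: "0 < l i" for i
  proof -
    have "0 < diameter (U i) powr u + e i" using e by (intro add_nonneg_pos) auto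
    then show ?thesis unfolding l_def by simp
  qed
  have ld: "diameter (U i) < l i" for i
  proof (rule ccontr)
    assume "\<not> diameter (U i) < l i"
    then have "l i powr u \<le> diameter (U i) powr u"
      using l0[of i] assms(3) by (intro powr_mono2) auto
    then show False using e[of i] lu[of i] by simp
  qed
  have "U i \<subseteq> ball (c i) (l i)" for i
  proof
    fix x assume x: "x \<in> U i"
    then have "c i \<in> U i" unfolding c_def by (rule someI)
    then have "dist (c i) x \<le> diameter (U i)" using U(2) x by (intro diameter_bounded_bound)
    then show "x \<in> ball (c i) (l i)" using ld[of i] by simp
  qed
  then have "(\<Union>i. U i) \<subseteq> (\<Union>i\<in>UNIV. ball (c i) (l i))" by (intro UN_mono subset_refl)
  with U(1) have cov: "F \<subseteq> (\<Union>i\<in>UNIV. ball (c i) (l i))" by (rule order_trans)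
  have op: "open (ball (c i) (l i))" for i by simp
  obtain I where I: "I \<subseteq> UNIV" "finite I" "F \<subseteq> (\<Union>i\<in>I. ball (c i) (l i))"
    by (rule compactE_image[where f = "\<lambda>i. ball (c i) (l i)", OF assms(1) op cov])
  have "(\<Sum>i\<in>I. ennreal (diameter (U i) powr u)) \<le> ennreal (\<epsilon> / 2)"
    by (rule order_trans[OF sum_le_suminf[OF summableI I(2)] less_imp_le[OF U(3)]]) simp
  then have 1: "(\<Sum>i\<in>I. diameter (U i) powr u) \<le> \<epsilon> / 2"
    using assms(4) by (simp add: sum_nonneg)
  have "(\<Sum>i\<in>I. (1/2::real) ^ Suc i) \<le> (\<Sum>i. (1/2) ^ Suc i)"
    using power_half_series I(2) by (intro sum_le_suminf) (auto simp: sums_iff)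
  then have "(\<Sum>i\<in>I. (1/2::real) ^ Suc i) \<le> 1"
    using power_half_series by (simp add: sums_iff)
  then have 2: "sum e I \<le> \<epsilon> / 2"
    unfolding e_def sum_distrib_left[symmetric] using assms(4)
    mult_left_mono[of "\<Sum>i\<in>I. (1/2::real) ^ Suc i" 1 "\<epsilon> / 2"] by simp
  have "(\<Sum>i\<in>I. l i powr u) \<le> \<epsilon>" unfolding lu sum.distrib using 1 2 by simp
  then show ?thesis using I(2,3) l0 by (intro exI[of _ I] exI[of _ c] exI[of _ l]) simp
qed

text \<open>By compactness, a cover of the slice by small intervals also covers the part of the graph
  close to the line, so a null slice forces large energy on weights concentrated near the line.\<close>

lemma null_slice_energy:
  fixes K :: "real set" and f :: "real \<Rightarrow> real"
  assumes "compact K" "continuous_on K f" "0 \<le> a" "a \<le> 1" "0 < u" "0 < \<epsilon>"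
    and null: "hausdorff_measure u {x \<in> K. f x = a * x + b} = 0"
  shows "\<exists>N0. \<forall>N\<ge>N0. \<forall>P w. finite P \<longrightarrow> P \<subseteq> K \<longrightarrow> (\<forall>x. 0 \<le> w x) \<longrightarrow>
           (\<forall>x\<in>P. \<bar>f x - a * x - b\<bar> \<le> (1/2) ^ N) \<longrightarrow>
           (sum w P)\<^sup>2 \<le> (\<Sum>x\<in>P. \<Sum>y\<in>P. w x * w y * coarse_dist f N x y powr - u) * \<epsilon>"
proof -
  let ?h = "\<lambda>x. \<bar>f x - a * x - b\<bar>"
  have cont: "continuous_on K ?h" by (intro continuous_intros assms)
  have "closed {x \<in> K. f x - a * x = b}"
    using assms(1,2) by (intro continuous_closed_preimage_constant continuous_intros compact_imp_closed)
  moreover have "{x \<in> K. f x - a * x = b} = {x \<in> K. f x = a * x + b}" by auto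
  ultimately have "compact (K \<inter> {x \<in> K. f x = a * x + b})"
    using assms(1) by (metis compact_Int_closed)
  moreover have "K \<inter> {x \<in> K. f x = a * x + b} = {x \<in> K. f x = a * x + b}" by auto
  ultimately have comp: "compact {x \<in> K. f x = a * x + b}" by simp
  \<comment> \<open>The divisor pays for replacing each radius \<open>l i\<close> by
    \<open>6 * l i\<close> below.\<close>
  have "0 < \<epsilon> / 6 powr u" using assms(6) by simp
  from hausdorff_null_finite_ball_cover[OF comp null assms(5) this]
  obtain I :: "nat set" and c l where I: "finite I" "\<And>i. i \<in> I \<Longrightarrow> 0 < l i"
    "{x \<in> K. f x = a * x + b} \<subseteq> (\<Union>i\<in>I. ball (c i) (l i))"
    "(\<Sum>i\<in>I. l i powr u) \<le> \<epsilon> / 6 powr u" by (elim exE conjE) (rule that, auto)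
  let ?C = "K - (\<Union>i\<in>I. ball (c i) (l i))"
  \<comment> \<open>On the compact uncovered part of \<open>K\<close> the vertical distance to the
    line has a positive minimum.\<close>
  have "\<exists>\<delta>>0. \<forall>x\<in>?C. \<delta> < ?h x"
  proof (cases "?C = {}")
    case False
    have "compact ?C" using assms(1) by (intro compact_diff open_UN) auto
    moreover have "continuous_on ?C ?h" by (rule continuous_on_subset[OF cont]) auto
    ultimately obtain z where z: "z \<in> ?C" "\<forall>x\<in>?C. ?h z \<le> ?h x"
      using continuous_attains_inf[of ?C ?h] False by blast
    have "f z \<noteq> a * z + b" using z(1) I(3) by blast
    then have hz: "0 < ?h z" by auto
    have "?h z / 2 < ?h x" if "x \<in> ?C" for x
    proof -
      have "?h z \<le> ?h x" using z(2) that by (rule bspec)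
      moreover have "r / 2 < r'" if "0 < r" "r \<le> r'" for r r' :: real using that by simp
      ultimately show ?thesis using hz by blast
    qed
    then show ?thesis using half_gt_zero[OF hz] by blast
  qed (auto intro: exI[of _ 1])
  then obtain \<delta> where \<delta>: "\<delta> > 0" "\<And>x. x \<in> ?C \<Longrightarrow> \<delta> < ?h x" by blast
  \<comment> \<open>Being at most \<open>\<delta>\<close> puts the points of a strip of this width
    into the balls; being at most every radius makes the strip error comparable to the ball.\<close>
  define \<eta> where "\<eta> = Min (insert \<delta> (l ` I))"
  have "0 < \<eta>" unfolding \<eta>_def using I(1,2) \<delta>(1) by (subst Min_gr_iff) auto
  have \<eta>: "\<eta> \<le> \<delta>" "\<And>i. i \<in> I \<Longrightarrow> \<eta> \<le> l i" unfolding \<eta>_def using I(1) by (auto intro: Min_le)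
  obtain N0 where N0: "(1/2) ^ N0 < \<eta>" using real_arch_pow_inv[OF \<open>0 < \<eta>\<close>, of "1/2"] by auto
  have "(sum w P)\<^sup>2 \<le> (\<Sum>x\<in>P. \<Sum>y\<in>P. w x * w y * coarse_dist f N x y powr - u) * \<epsilon>"
    if N: "N0 \<le> N" and P: "finite P" "P \<subseteq> K" "\<forall>x. 0 \<le> w x" "\<forall>x\<in>P. ?h x \<le> (1/2) ^ N" for N P w
  proof -
    have "(1/2::real) ^ N \<le> (1/2) ^ N0" using N by (intro power_decreasing) auto
    then have small: "(1/2) ^ N \<le> \<eta>" by (rule order.trans[OF _ less_imp_le[OF N0]])
    have "\<exists>i\<in>I. x \<in> ball (c i) (l i)" if "x \<in> P" for x
    proof (rule ccontr)
      assume "\<not> (\<exists>i\<in>I. x \<in> ball (c i) (l i))"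
      then have "\<delta> < ?h x" using that P(2) by (intro \<delta>(2)) auto
      then show False using P(4) that small \<eta>(1) by force
    qed
    then obtain g where g: "\<And>x. x \<in> P \<Longrightarrow> g x \<in> I" "\<And>x. x \<in> P \<Longrightarrow> x \<in> ball (c (g x)) (l (g x))"
      by metis
    have "(sum w P)\<^sup>2 \<le> (\<Sum>x\<in>P. \<Sum>y\<in>P. w x * w y * coarse_dist f N x y powr - u) *
        (\<Sum>i\<in>I. (6 * l i) powr u)"
    proof (rule square_sum_le_energy[where g = g])
      fix x y assume xy: "x \<in> P" "y \<in> P" "g x = g y"
      define r where "r = l (g x)"
      have r: "0 < r" "(1/2) ^ N \<le> r" using I(2) g(1) xy \<eta>(2)[of "g x"] small by (auto simp: r_def)
      have "dist x y < 2 * r"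
        using g(2)[OF xy(1)] g(2)[OF xy(2)] dist_triangle_less_add[of x "c (g x)" r y r] xy(3)
        by (simp add: r_def dist_commute)
      then have xy1: "\<bar>x - y\<bar> \<le> 2 * r" by (simp add: dist_real_def)
      \<comment> \<open>Sharing a ball costs \<open>2 * r\<close> horizontally. Vertically, the
        slope contributes \<open>2 * r\<close> and the two strip errors \<open>r\<close> each,
        whence the factor 6.\<close>
      have "\<bar>a * (x - y)\<bar> \<le> 1 * (2 * r)"
        unfolding abs_mult using assms(3,4) xy1 by (intro mult_mono) auto
      moreover have "f x - f y = (f x - a * x - b) - (f y - a * y - b) + a * (x - y)"
        by (simp add: algebra_simps)
      moreover have "?h x \<le> r" "?h y \<le> r" using P(4) xy r(2) by force+
      ultimately have "\<bar>f x - f y\<bar> \<le> 4 * r" by linarith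
      then have "coarse_dist f N x y \<le> 6 * r"
        unfolding coarse_dist_def using xy1 r by simp
      then have "(6 * r) powr - u \<le> coarse_dist f N x y powr - u"
        using assms(5) coarse_dist_pos by (intro powr_mono2') auto
      then show "1 / (6 * l (g x)) powr u \<le> coarse_dist f N x y powr - u"
        by (simp add: r_def powr_minus_divide)
    qed (use P(1,3) I(1) I(2)[THEN less_imp_neq, symmetric] g(1) in auto)
    also have "\<dots> \<le> (\<Sum>x\<in>P. \<Sum>y\<in>P. w x * w y * coarse_dist f N x y powr - u) * \<epsilon>"
    proof (rule mult_left_mono)
      have "(\<Sum>i\<in>I. (6 * l i) powr u) = 6 powr u * (\<Sum>i\<in>I. l i powr u)"
        by (simp add: powr_mult sum_distrib_left)
      then show "(\<Sum>i\<in>I. (6 * l i) powr u) \<le> \<epsilon>"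
        using I(4) by (simp add: pos_le_divide_eq mult.commute)
    qed (use P(3) in \<open>auto intro!: sum_nonneg mult_nonneg_nonneg\<close>)
    finally show ?thesis .
  qed
  then show ?thesis by (intro exI[of _ N0]) blast
qed

text \<open>A line is encoded as the pair of its slope and its intercept.\<close>

definition near_lines :: "(real \<Rightarrow> real) \<Rightarrow> real \<Rightarrow> real \<Rightarrow> (real \<times> real) set" where
  "near_lines f \<delta> x = {p. fst p \<in> {0..1} \<and> \<bar>(f x - fst p * x) - snd p\<bar> \<le> \<delta>}"

section \<open>Measure of the lines near one or two points\<close>

lemma near_lines_measurable:
  assumes "0 \<le> \<delta>"
  shows "near_lines f \<delta> x \<in> sets borel"
    and "emeasure lborel (near_lines f \<delta> x) = ennreal (2 * \<delta>)"
  using emeasure_lborel_strip[of "{0..1}" "\<lambda>a. f x - a * x" \<delta>] assms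
  unfolding near_lines_def by auto

text \<open>Transversality: subtracting the two strip conditions confines the slope to a set
  \<open>T\<close> of measure at most \<open>16 * \<delta> / ?D\<close>; for each slope the
  intercept ranges over an interval of length \<open>2 * \<delta>\<close>.\<close>

lemma emeasure_near_lines_Int:
  assumes "\<delta> = (1/2) ^ N"
  shows "emeasure lborel (near_lines f \<delta> x \<inter> near_lines f \<delta> y) \<le> ennreal (32 * \<delta>\<^sup>2 / coarse_dist f N x y)"
proof -
  let ?D = "coarse_dist f N x y"
  define d where "d = \<bar>x - y\<bar> + \<bar>f x - f y\<bar>"
  define T where "T = {a \<in> {0..1}. \<bar>(f x - f y) - a * (x - y)\<bar> \<le> 2 * \<delta>}"
  have \<delta>: "0 < \<delta>" and D: "?D = max d \<delta>" using assms by (auto simp: coarse_dist_def d_def)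
  have "closed ({0..1} \<inter> {a. \<bar>(f x - f y) - a * (x - y)\<bar> \<le> 2 * \<delta>})"
    by (intro closed_Int closed_atLeastAtMost closed_Collect_le continuous_intros)
  moreover have "{0..1} \<inter> {a. \<bar>(f x - f y) - a * (x - y)\<bar> \<le> 2 * \<delta>} = T" by (auto simp: T_def)
  ultimately have T: "T \<in> sets borel" by (simp add: borel_closed)
  have T_small: "emeasure lborel T \<le> ennreal (16 * \<delta> / ?D)"
  proof (cases "d \<le> 4 * \<delta>")
    case True
    have "T \<subseteq> {0..1}" by (auto simp: T_def)
    then have "emeasure lborel T \<le> emeasure lborel {0..1::real}" by (intro emeasure_mono) auto
    also have "\<dots> = ennreal 1" by simp
    also have "\<dots> \<le> ennreal (16 * \<delta> / ?D)"
      using True \<delta> D by (intro ennreal_leI) (simp add: field_simps)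
    finally show ?thesis .
  next
    case False
    then have Dd: "?D = d" using D \<delta> by auto
    show ?thesis
    proof (cases "d \<le> 4 * \<bar>x - y\<bar>")
      case True
      then have xy: "0 < \<bar>x - y\<bar>" using False \<delta> by auto
      \<comment> \<open>The secant slope; slopes in \<open>T\<close> stay within \<open>r\<close> of
        it.\<close>
      define m where "m = (f x - f y) / (x - y)"
      define r where "r = 2 * \<delta> / \<bar>x - y\<bar>"
      have r0: "0 \<le> r" using \<delta> by (simp add: r_def)
      have "T \<subseteq> {m - r..m + r}"
      proof
        fix a assume "a \<in> T"
        then have "\<bar>(f x - f y) - a * (x - y)\<bar> \<le> 2 * \<delta>" by (simp add: T_def)
        moreover have "(f x - f y) - a * (x - y) = (m - a) * (x - y)"
          using xy by (simp add: m_def field_simps)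
        ultimately have "\<bar>m - a\<bar> * \<bar>x - y\<bar> \<le> 2 * \<delta>" by (simp add: abs_mult)
        then have "\<bar>m - a\<bar> \<le> r" using xy by (simp add: r_def pos_le_divide_eq)
        then show "a \<in> {m - r..m + r}" by auto
      qed
      then have "emeasure lborel T \<le> emeasure lborel {m - r..m + r}" by (intro emeasure_mono) auto
      also have "\<dots> = ennreal (2 * r)" using r0 by simp
      also have "\<dots> \<le> ennreal (16 * \<delta> / ?D)"
      proof (rule ennreal_leI)
        have "2 * r = 4 * \<delta> / \<bar>x - y\<bar>" by (simp add: r_def)
        also have "\<dots> \<le> 4 * \<delta> / (d / 4)" using True xy \<delta> False by (intro divide_left_mono) auto
        finally show "2 * r \<le> 16 * \<delta> / ?D" unfolding Dd by simp
      qed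
      finally show ?thesis .
    next
      case far: False
      \<comment> \<open>The vertical gap exceeds three times the horizontal one. A slope in
        \<open>T\<close> would bound it by \<open>\<bar>x - y\<bar> + 2 * \<delta>\<close>, so
        \<open>\<bar>x - y\<bar> < \<delta>\<close> and \<open>d < 4 * \<delta>\<close>, a
        contradiction.\<close>
      have "a \<notin> T" for a
      proof
        assume a: "a \<in> T"
        define q where "q = a * (x - y)"
        have "\<bar>q\<bar> \<le> 1 * \<bar>x - y\<bar>"
          unfolding q_def abs_mult using a by (intro mult_right_mono) (auto simp: T_def)
        moreover have "\<bar>(f x - f y) - q\<bar> \<le> 2 * \<delta>" using a by (simp add: T_def q_def)
        moreover have "\<bar>f x - f y\<bar> \<le> \<bar>(f x - f y) - q\<bar> + \<bar>q\<bar>"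
          using abs_triangle_ineq[of "(f x - f y) - q" q] by simp
        ultimately have "Y \<le> X + 2 * \<delta>" if "X = \<bar>x - y\<bar>" "Y = \<bar>f x - f y\<bar>" for X Y
          unfolding that by simp
        moreover have "False" if "Y \<le> X + 2 * \<delta>" "\<not> X + Y \<le> 4 * X" "\<not> X + Y \<le> 4 * \<delta>" for X Y
          using that by simp
        ultimately show False using far False unfolding d_def by blast
      qed
      then have "T = {}" by auto
      then show ?thesis by simp
    qed
  qed
  have "near_lines f \<delta> x \<inter> near_lines f \<delta> y \<subseteq> {p. fst p \<in> T \<and> \<bar>(f x - fst p * x) - snd p\<bar> \<le> \<delta>}"
  proof
    fix p assume p: "p \<in> near_lines f \<delta> x \<inter> near_lines f \<delta> y"
    have "(f x - f y) - fst p * (x - y) = ((f x - fst p * x) - snd p) - ((f y - fst p * y) - snd p)"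
      by (simp add: algebra_simps)
    then show "p \<in> {p. fst p \<in> T \<and> \<bar>(f x - fst p * x) - snd p\<bar> \<le> \<delta>}"
      using p unfolding near_lines_def T_def by auto
  qed
  then have "emeasure lborel (near_lines f \<delta> x \<inter> near_lines f \<delta> y) \<le>
      emeasure lborel {p. fst p \<in> T \<and> \<bar>(f x - fst p * x) - snd p\<bar> \<le> \<delta>}"
    using T \<delta> by (intro emeasure_mono) (auto intro!: emeasure_lborel_strip(1)[of T "\<lambda>a. f x - a * x" \<delta>])
  also have "\<dots> = ennreal (2 * \<delta>) * emeasure lborel T"
    using T \<delta> by (intro emeasure_lborel_strip(2)) auto
  also have "\<dots> \<le> ennreal (2 * \<delta>) * ennreal (16 * \<delta> / ?D)"
    using T_small by (intro mult_left_mono) auto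
  also have "\<dots> = ennreal (32 * \<delta>\<^sup>2 / ?D)"
    using \<delta> by (subst ennreal_mult''[symmetric]) (auto simp: power2_eq_square coarse_dist_pos less_imp_le)
  finally show ?thesis .
qed

subsection \<open>Slices of large dimension\<close>

text \<open>The scaling makes the integral of the mass over all lines equal to twice the total
  weight, independently of the strip width.\<close>

definition slice_weight :: "(real \<Rightarrow> real) \<Rightarrow> nat \<Rightarrow> (real \<Rightarrow> real) \<Rightarrow> real \<times> real \<Rightarrow> real \<Rightarrow> real" where
  "slice_weight f N \<nu> p x = \<nu> x * indicator (near_lines f ((1/2) ^ N) x) p / (1/2) ^ N"

definition slice_mass :: "(real \<Rightarrow> real) \<Rightarrow> nat \<Rightarrow> real set \<Rightarrow> (real \<Rightarrow> real) \<Rightarrow> real \<times> real \<Rightarrow> real" where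
  "slice_mass f N P \<nu> p = sum (slice_weight f N \<nu> p) P"

definition slice_energy ::
  "real \<Rightarrow> (real \<Rightarrow> real) \<Rightarrow> nat \<Rightarrow> real set \<Rightarrow> (real \<Rightarrow> real) \<Rightarrow> real \<times> real \<Rightarrow> real" where
  "slice_energy u f N P \<nu> p = (\<Sum>x\<in>P. \<Sum>y\<in>P.
     slice_weight f N \<nu> p x * slice_weight f N \<nu> p y * coarse_dist f N x y powr - u)"

text \<open>Division by zero is harmless here: the mass vanishes together with the energy.\<close>

definition slice_capacity ::
  "real \<Rightarrow> (real \<Rightarrow> real) \<Rightarrow> nat \<Rightarrow> real set \<Rightarrow> (real \<Rightarrow> real) \<Rightarrow> real \<times> real \<Rightarrow> real" where
  "slice_capacity u f N P \<nu> p = (slice_mass f N P \<nu> p)\<^sup>2 / slice_energy u f N P \<nu> p"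

section \<open>Mean mass and mean energy of slices\<close>

lemma slice_weight_nonneg: "(\<And>x. 0 \<le> \<nu> x) \<Longrightarrow> 0 \<le> slice_weight f N \<nu> p x"
  by (simp add: slice_weight_def)

lemma slice_energy_nonneg: "(\<And>x. 0 \<le> \<nu> x) \<Longrightarrow> 0 \<le> slice_energy u f N P \<nu> p"
  unfolding slice_energy_def by (intro sum_nonneg mult_nonneg_nonneg slice_weight_nonneg) auto

lemma measure_near_lines:
  "integrable lborel (indicator (near_lines f ((1/2) ^ N) x) :: _ \<Rightarrow> real)"
  "measure lborel (near_lines f ((1/2) ^ N) x) = 2 * (1/2) ^ N"
  using near_lines_measurable[of "(1/2) ^ N" f x]
  by (auto simp: measure_def intro!: integrable_real_indicator)

lemma measure_near_lines_Int:
  "integrable lborel (indicator (near_lines f ((1/2) ^ N) x \<inter> near_lines f ((1/2) ^ N) y) :: _ \<Rightarrow> real)"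
  "measure lborel (near_lines f ((1/2) ^ N) x \<inter> near_lines f ((1/2) ^ N) y) \<le>
     32 * ((1/2) ^ N)\<^sup>2 / coarse_dist f N x y"
proof -
  have le: "emeasure lborel (near_lines f ((1/2) ^ N) x \<inter> near_lines f ((1/2) ^ N) y) \<le>
      ennreal (32 * ((1/2) ^ N)\<^sup>2 / coarse_dist f N x y)"
    by (rule emeasure_near_lines_Int) simp
  have sets: "near_lines f ((1/2) ^ N) z \<in> sets lborel" for z
    using near_lines_measurable(1) by simp
  have "emeasure lborel (near_lines f ((1/2) ^ N) x \<inter> near_lines f ((1/2) ^ N) y) < \<infinity>"
    using le by (rule order_le_less_trans) simp
  then show "integrable lborel (indicator (near_lines f ((1/2) ^ N) x \<inter> near_lines f ((1/2) ^ N) y) :: _ \<Rightarrow> real)"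
    using sets by (intro integrable_real_indicator sets.Int)
  show "measure lborel (near_lines f ((1/2) ^ N) x \<inter> near_lines f ((1/2) ^ N) y) \<le>
      32 * ((1/2) ^ N)\<^sup>2 / coarse_dist f N x y"
    unfolding measure_def using le coarse_dist_pos[of f N x y] by (intro enn2real_leI) auto
qed

lemma integral_slice_mass:
  shows "integrable lborel (slice_mass f N P \<nu>)"
    and "integral\<^sup>L lborel (slice_mass f N P \<nu>) = 2 * sum \<nu> P"
proof -
  let ?g = "\<lambda>x p. \<nu> x / (1/2) ^ N * indicator (near_lines f ((1/2) ^ N) x) p"
  have eq: "slice_mass f N P \<nu> = (\<lambda>p. \<Sum>x\<in>P. ?g x p)"
    by (simp add: fun_eq_iff slice_mass_def slice_weight_def)
  have int: "integrable lborel (?g x)" for x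
    by (intro integrable_mult_right measure_near_lines)
  then show "integrable lborel (slice_mass f N P \<nu>)"
    unfolding eq by (intro Bochner_Integration.integrable_sum)
  have "integral\<^sup>L lborel (?g x) = 2 * \<nu> x" for x
    by (simp add: measure_near_lines(2))
  then show "integral\<^sup>L lborel (slice_mass f N P \<nu>) = 2 * sum \<nu> P"
    unfolding eq using int by (simp only: Bochner_Integration.integral_sum sum_distrib_left)
qed

text \<open>In the measure of the lines near two points, the squared strip width cancels the
  scaling, and the factor \<open>1 / coarse_dist f N x y\<close> raises the exponent from
  \<open>u\<close> to \<open>u + 1\<close>.\<close>

lemma integral_slice_energy:
  assumes "\<And>x. 0 \<le> \<nu> x"
  shows "integrable lborel (slice_energy u f N P \<nu>)"
    and "integral\<^sup>L lborel (slice_energy u f N P \<nu>) \<le>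
      32 * (\<Sum>x\<in>P. \<Sum>y\<in>P. \<nu> x * \<nu> y * coarse_dist f N x y powr - (u + 1))"
proof -
  let ?\<delta> = "(1/2::real) ^ N"
  let ?A = "\<lambda>x y. near_lines f ?\<delta> x \<inter> near_lines f ?\<delta> y"
  let ?k = "\<lambda>x y. \<nu> x * \<nu> y * coarse_dist f N x y powr - u / ?\<delta>\<^sup>2"
  let ?g = "\<lambda>x y p. ?k x y * indicator (?A x y) p"
  have eq: "slice_energy u f N P \<nu> = (\<lambda>p. \<Sum>x\<in>P. \<Sum>y\<in>P. ?g x y p)"
    by (simp add: fun_eq_iff slice_energy_def slice_weight_def indicator_inter_arith power2_eq_square mult_ac)
  have int: "integrable lborel (?g x y)" for x y
    by (intro integrable_mult_right measure_near_lines_Int)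
  then show "integrable lborel (slice_energy u f N P \<nu>)"
    unfolding eq by (intro Bochner_Integration.integrable_sum)
  have le: "integral\<^sup>L lborel (?g x y) \<le> 32 * (\<nu> x * \<nu> y * coarse_dist f N x y powr - (u + 1))" for x y
  proof -
    have "integral\<^sup>L lborel (?g x y) = ?k x y * measure lborel (?A x y)" by simp
    also have "\<dots> \<le> ?k x y * (32 * ?\<delta>\<^sup>2 / coarse_dist f N x y)"
      using assms by (intro mult_left_mono measure_near_lines_Int) auto
    also have "\<dots> = 32 * (\<nu> x * \<nu> y * (coarse_dist f N x y powr - u / coarse_dist f N x y))"
      by simp
    also have "coarse_dist f N x y powr - u / coarse_dist f N x y = coarse_dist f N x y powr - (u + 1)"
      using coarse_dist_pos[of f N x y] powr_diff[of "coarse_dist f N x y" "- u" 1] by simp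
    finally show ?thesis .
  qed
  have "integral\<^sup>L lborel (slice_energy u f N P \<nu>) = (\<Sum>x\<in>P. \<Sum>y\<in>P. integral\<^sup>L lborel (?g x y))"
    unfolding eq using int by (simp only: Bochner_Integration.integral_sum Bochner_Integration.integrable_sum)
  also have "\<dots> \<le> (\<Sum>x\<in>P. \<Sum>y\<in>P. 32 * (\<nu> x * \<nu> y * coarse_dist f N x y powr - (u + 1)))"
    by (intro sum_mono le)
  finally show "integral\<^sup>L lborel (slice_energy u f N P \<nu>) \<le>
      32 * (\<Sum>x\<in>P. \<Sum>y\<in>P. \<nu> x * \<nu> y * coarse_dist f N x y powr - (u + 1))"
    by (simp only: sum_distrib_left)
qed

text \<open>Taking \<open>P\<close> as a single group in \<open>square_sum_le_energy\<close> bounds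
  the ratio and makes the mass vanish with the energy. The last inequality is a completed square
  divided by the energy; being linear in mass and energy, it can be integrated.\<close>

lemma slice_capacity_bounds:
  assumes "finite P" "\<And>x. 0 \<le> \<nu> x" "0 \<le> u" and D: "\<And>x y. x \<in> P \<Longrightarrow> y \<in> P \<Longrightarrow> coarse_dist f N x y \<le> D"
  shows "0 \<le> slice_capacity u f N P \<nu> p" "slice_capacity u f N P \<nu> p \<le> D powr u"
    and "2 * \<alpha> * slice_mass f N P \<nu> p \<le> \<alpha>\<^sup>2 * slice_energy u f N P \<nu> p + slice_capacity u f N P \<nu> p"
proof -
  let ?M = "slice_mass f N P \<nu> p" and ?J = "slice_energy u f N P \<nu> p"
  have J0: "0 \<le> ?J" using assms(2) by (rule slice_energy_nonneg)
  show "0 \<le> slice_capacity u f N P \<nu> p" unfolding slice_capacity_def using J0 by simp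
  have MJ: "?M\<^sup>2 \<le> ?J * D powr u"
  proof (cases "P = {}")
    case True
    then show ?thesis by (simp add: slice_mass_def slice_energy_def)
  next
    case False
    then obtain z where "z \<in> P" by blast
    then have D0: "0 < D" using D[of z z] coarse_dist_pos[of f N z z] by linarith
    have "?M\<^sup>2 \<le> ?J * sum (\<lambda>_. D powr u) {()}"
      unfolding slice_mass_def slice_energy_def
    proof (rule square_sum_le_energy[where g = "\<lambda>_. ()"])
      fix x y assume "x \<in> P" "y \<in> P"
      then have "D powr - u \<le> coarse_dist f N x y powr - u"
        using assms(3) D coarse_dist_pos by (intro powr_mono2') auto
      then show "1 / D powr u \<le> coarse_dist f N x y powr - u" by (simp add: powr_minus_divide)
    qed (use assms(1,2) D0 slice_weight_nonneg in auto)
    then show ?thesis by simp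
  qed
  show "slice_capacity u f N P \<nu> p \<le> D powr u"
    using MJ J0 by (cases "?J = 0") (auto simp: slice_capacity_def field_simps)
  show "2 * \<alpha> * ?M \<le> \<alpha>\<^sup>2 * ?J + slice_capacity u f N P \<nu> p"
  proof (cases "?J = 0")
    case True
    then show ?thesis using MJ by (simp add: slice_capacity_def)
  next
    case False
    then have "0 < ?J" using J0 by simp
    have "0 \<le> (\<alpha> * ?J - ?M)\<^sup>2 / ?J" using J0 by simp
    also have "\<dots> = \<alpha>\<^sup>2 * ?J + slice_capacity u f N P \<nu> p - 2 * \<alpha> * ?M"
      using False by (simp add: slice_capacity_def field_simps power2_eq_square)
    finally show ?thesis by simp
  qed
qed

lemma slice_capacity_measurable: "slice_capacity u f N P \<nu> \<in> borel_measurable lborel"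
  if "\<And>x. 0 \<le> \<nu> x"
proof -
  have [measurable]: "slice_mass f N P \<nu> \<in> borel_measurable lborel"
    "slice_energy u f N P \<nu> \<in> borel_measurable lborel"
    using integral_slice_mass(1) integral_slice_energy(1) that
    by (blast intro: borel_measurable_integrable)+
  show ?thesis unfolding slice_capacity_def by measurable
qed

lemma slice_capacity_outside:
  assumes "\<And>x. x \<in> P \<Longrightarrow> p \<notin> near_lines f ((1/2) ^ N) x"
  shows "slice_capacity u f N P \<nu> p = 0"
  using assms by (simp add: slice_capacity_def slice_mass_def slice_weight_def)

text \<open>\<open>null_slice_energy\<close> is applied to the points within the strip of the line:
  restricting to them keeps the mass and does not raise the energy.\<close>

lemma slice_capacity_null_slice:
  assumes "compact K" "continuous_on K f" "fst p \<in> {0..1}" "0 < u"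
    and "hausdorff_measure u {x \<in> K. f x = fst p * x + snd p} = 0"
    and P: "\<And>N. finite (P N)" "\<And>N. P N \<subseteq> K" and \<nu>: "\<And>N x. 0 \<le> \<nu> N x"
  shows "(\<lambda>N. slice_capacity u f N (P N) (\<nu> N) p) \<longlonglongrightarrow> 0"
proof (rule LIMSEQ_I)
  fix r :: real assume "0 < r"
  then have "0 < r / 2" by simp
  from null_slice_energy[OF assms(1,2) _ _ assms(4) this assms(5)] assms(3)
  obtain N0 where N0: "\<forall>N\<ge>N0. \<forall>P w. finite P \<longrightarrow> P \<subseteq> K \<longrightarrow> (\<forall>x. 0 \<le> w x) \<longrightarrow>
      (\<forall>x\<in>P. \<bar>f x - fst p * x - snd p\<bar> \<le> (1/2) ^ N) \<longrightarrow>
      (sum w P)\<^sup>2 \<le> (\<Sum>x\<in>P. \<Sum>y\<in>P. w x * w y * coarse_dist f N x y powr - u) * (r / 2)"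
    by auto
  have le: "slice_capacity u f N (P N) (\<nu> N) p \<le> r / 2" if N: "N0 \<le> N" for N
  proof -
    let ?w = "slice_weight f N (\<nu> N) p"
    let ?J = "slice_energy u f N (P N) (\<nu> N) p"
    let ?k = "\<lambda>x y. ?w x * ?w y * coarse_dist f N x y powr - u"
    define Q where "Q = {x \<in> P N. p \<in> near_lines f ((1/2) ^ N) x}"
    have w0: "0 \<le> ?w x" for x by (rule slice_weight_nonneg) (rule \<nu>)
    have J0: "0 \<le> ?J" by (rule slice_energy_nonneg) (rule \<nu>)
    have Q: "finite Q" "Q \<subseteq> K" "Q \<subseteq> P N" using P by (auto simp: Q_def)
    have near: "\<forall>x\<in>Q. \<bar>f x - fst p * x - snd p\<bar> \<le> (1/2) ^ N"
      by (auto simp: Q_def near_lines_def)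
    have "slice_mass f N (P N) (\<nu> N) p = sum ?w Q"
      unfolding slice_mass_def using P(1) by (intro sum.mono_neutral_right)
        (auto simp: Q_def slice_weight_def)
    moreover have "(sum ?w Q)\<^sup>2 \<le> (\<Sum>x\<in>Q. \<Sum>y\<in>Q. ?k x y) * (r / 2)"
      using N0 N Q(1,2) w0 near by blast
    moreover
    have "(\<Sum>x\<in>Q. \<Sum>y\<in>Q. ?k x y) \<le> ?J"
    proof -
      have "(\<Sum>x\<in>Q. \<Sum>y\<in>Q. ?k x y) \<le> (\<Sum>x\<in>Q. \<Sum>y\<in>P N. ?k x y)"
        using P(1) Q(3) w0 by (intro sum_mono sum_mono2) auto
      also have "\<dots> \<le> (\<Sum>x\<in>P N. \<Sum>y\<in>P N. ?k x y)"
        using P(1) Q(3) w0 by (intro sum_mono2 sum_nonneg) auto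
      finally show ?thesis unfolding slice_energy_def .
    qed
    then have "(\<Sum>x\<in>Q. \<Sum>y\<in>Q. ?k x y) * (r / 2) \<le> ?J * (r / 2)"
      by (rule mult_right_mono) (use \<open>0 < r / 2\<close> in simp)
    ultimately have "(slice_mass f N (P N) (\<nu> N) p)\<^sup>2 \<le> ?J * (r / 2)" by simp
    then show ?thesis
      using J0 \<open>0 < r\<close> by (cases "?J = 0") (auto simp: slice_capacity_def pos_divide_le_eq mult.commute)
  qed
  have nonneg: "0 \<le> slice_capacity u f N (P N) (\<nu> N) p" for N
    unfolding slice_capacity_def using slice_energy_nonneg[of "\<nu> N"] \<nu> by simp
  have "norm (slice_capacity u f N (P N) (\<nu> N) p - 0) < r" if "N0 \<le> N" for N
    using le[OF that] nonneg[of N] \<open>0 < r\<close> by simp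
  then show "\<exists>no. \<forall>n\<ge>no. norm (slice_capacity u f n (P n) (\<nu> n) p - 0) < r" by blast
qed

text \<open>\<open>V\<close> holds the exponents for the upper bound. Almost every line has null
  slices for all of them, so if the claim failed, almost every slice with slope in
  \<open>{0..1}\<close> would be \<open>u\<close>-null.\<close>

lemma exists_large_slice:
  fixes K :: "real set" and f :: "real \<Rightarrow> real"
  assumes "compact K" "K \<subseteq> {0..1}" "continuous_on K f" "0 < u" "u + 1 < t"
    and "hausdorff_measure t (graph_on K f) \<noteq> 0"
    and V: "countable V" "\<And>v. v \<in> V \<Longrightarrow> 1 < v" "\<And>v. v \<in> V \<Longrightarrow> hausdorff_measure v (graph_on K f) = 0"
  shows "\<exists>a\<in>{0..1}. \<exists>b. hausdorff_measure u {x \<in> K. f x = a * x + b} \<noteq> 0 \<and>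
           (\<forall>v\<in>V. hausdorff_measure (v - 1) {x \<in> K. f x = a * x + b} = 0)"
proof (rule ccontr)
  assume contra: "\<not> ?thesis"
  have bdK: "bounded K" using assms(1) by (rule compact_imp_bounded)
  have bdf: "bounded (f ` K)"
    using assms(1,3) by (intro compact_imp_bounded compact_continuous_image)
  obtain R where "0 < R" "\<forall>y\<in>f ` K. norm y \<le> R"
    using bdf unfolding bounded_pos by blast
  then have R: "\<And>x. x \<in> K \<Longrightarrow> \<bar>f x\<bar> \<le> R" "0 \<le> R" by auto
  have t': "0 \<le> u + 1" using assms(4) by simp
  define A where "A c E N P \<nu> \<longleftrightarrow> finite P \<and> P \<subseteq> K \<and> (\<forall>x. 0 \<le> \<nu> x) \<and> c \<le> sum \<nu> P \<and>
      (\<Sum>x\<in>P. \<Sum>y\<in>P. \<nu> x * \<nu> y * coarse_dist f N x y powr - (u + 1)) \<le> E" for c E N P \<nu>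
  have "\<exists>c>0. \<exists>E. \<forall>N. \<exists>P \<nu>. A c E N P \<nu>"
    unfolding A_def by (rule discrete_frostman[OF bdK bdf assms(6) t' assms(5)])
  then obtain c E where "c > 0" and "\<forall>N. \<exists>P \<nu>. A c E N P \<nu>" by blast
  then obtain P \<nu> where "\<And>N. A c E N (P N) (\<nu> N)" by metis
  then have P: "\<And>N. finite (P N)" "\<And>N. P N \<subseteq> K" and \<nu>: "\<And>N x. 0 \<le> \<nu> N x"
    and mass: "\<And>N. c \<le> sum (\<nu> N) (P N)"
    and energy: "\<And>N. (\<Sum>x\<in>P N. \<Sum>y\<in>P N. \<nu> N x * \<nu> N y * coarse_dist f N x y powr - (u + 1)) \<le> E"
    unfolding A_def by auto
  define \<phi> where "\<phi> N = slice_capacity u f N (P N) (\<nu> N)" for N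
  define D where "D = 2 * R + 2"
  have D: "coarse_dist f N x y \<le> D" if "x \<in> P N" "y \<in> P N" for N x y
  proof -
    have xy: "x \<in> K" "y \<in> K" using that P(2) by auto
    then have "x \<in> {0..1}" "y \<in> {0..1}" using assms(2) by auto
    then have "\<bar>x - y\<bar> \<le> 1" by auto
    moreover have "\<bar>f x - f y\<bar> \<le> 2 * R" using R(1)[OF xy(1)] R(1)[OF xy(2)] by linarith
    moreover have "(1/2::real) ^ N \<le> 1" by (intro power_le_one) auto
    ultimately show ?thesis unfolding coarse_dist_def D_def using R(2) by simp
  qed
  have cap: "0 \<le> \<phi> N p" "\<phi> N p \<le> D powr u"
    "2 * \<alpha> * slice_mass f N (P N) (\<nu> N) p \<le> \<alpha>\<^sup>2 * slice_energy u f N (P N) (\<nu> N) p + \<phi> N p" for N p \<alpha>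
    unfolding \<phi>_def
    using slice_capacity_bounds[of "P N" "\<nu> N" u f N D, OF P(1) \<nu> less_imp_le[OF assms(4)] D] by auto
  \<comment> \<open>Lines with a chance to meet a strip: the intercept is at most \<open>R\<close>
    for the function, plus 1 for the slope term, plus 1 for the strip width.\<close>
  define Box where "Box = {p :: real \<times> real. fst p \<in> {0..1} \<and> \<bar>0 - snd p\<bar> \<le> R + 2}"
  have Box: "Box \<in> sets borel" "emeasure lborel Box = ennreal (2 * (R + 2))"
    using emeasure_lborel_strip[of "{0..1}" "\<lambda>_. 0" "R + 2"] R(2) unfolding Box_def by auto
  have outside: "\<phi> N p = 0" if "p \<notin> Box" for N p
    unfolding \<phi>_def
  proof (rule slice_capacity_outside)
    fix x assume "x \<in> P N"
    then have x: "x \<in> K" using P(2) by blast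
    show "p \<notin> near_lines f ((1/2) ^ N) x"
    proof
      assume p: "p \<in> near_lines f ((1/2) ^ N) x"
      have "\<bar>fst p * x\<bar> \<le> 1 * 1"
        unfolding abs_mult using p x assms(2) by (intro mult_mono) (auto simp: near_lines_def)
      moreover have "(1/2::real) ^ N \<le> 1" by (intro power_le_one) auto
      moreover have "\<bar>(f x - fst p * x) - snd p\<bar> \<le> (1/2) ^ N" "fst p \<in> {0..1}"
        using p by (auto simp: near_lines_def)
      ultimately have "\<bar>snd p\<bar> \<le> R + 2" using R(1)[OF x] by linarith
      then show False using that \<open>fst p \<in> {0..1}\<close> by (simp add: Box_def)
    qed
  qed
  have meas [measurable]: "\<phi> N \<in> borel_measurable lborel" for N
    unfolding \<phi>_def by (rule slice_capacity_measurable) (rule \<nu>)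
  have dom: "norm (\<phi> N p) \<le> D powr u * indicator Box p" for N p
    using cap(1,2)[of N p] outside[of p N] by (cases "p \<in> Box") auto
  have int_dom: "integrable lborel (\<lambda>p. D powr u * indicator Box p)"
    using Box by (intro integrable_mult_right integrable_real_indicator) auto
  have int_\<phi>: "integrable lborel (\<phi> N)" for N
    by (rule Bochner_Integration.integrable_bound[OF int_dom meas]) (use dom[of N] in \<open>force intro!: AE_I2\<close>)
  have "AE p in lborel. \<forall>v\<in>V. fst p \<in> {0..1} \<longrightarrow>
      hausdorff_measure (v - 1) {x. (x, fst p * x + snd p) \<in> graph_on K f} = 0"
    unfolding AE_ball_countable[OF V(1)] using V(2,3) by (blast intro: AE_hausdorff_measure_slice_null)
  then have "AE p in lborel. (\<lambda>N. \<phi> N p) \<longlonglongrightarrow> 0"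
  proof eventually_elim
    case (elim p)
    show ?case
    proof (cases "fst p \<in> {0..1}")
      case True
      have slice: "{x. (x, fst p * x + snd p) \<in> graph_on K f} = {x \<in> K. f x = fst p * x + snd p}"
        by (auto simp: graph_on_def)
      have "hausdorff_measure u {x \<in> K. f x = fst p * x + snd p} = 0"
        using contra elim True unfolding slice by blast
      then show ?thesis
        unfolding \<phi>_def by (intro slice_capacity_null_slice[OF assms(1,3) True assms(4) _ P \<nu>])
    next
      case False
      then have "p \<notin> Box" unfolding Box_def by blast
      then show ?thesis by (simp add: outside)
    qed
  qed
  then have "(\<lambda>N. integral\<^sup>L lborel (\<phi> N)) \<longlonglongrightarrow> integral\<^sup>L lborel (\<lambda>_ :: real \<times> real. 0 :: real)"
    using dom by (intro integral_dominated_convergence[OF _ _ int_dom]) auto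
  then have lim: "(\<lambda>N. integral\<^sup>L lborel (\<phi> N)) \<longlonglongrightarrow> 0" by simp
  define E' where "E' = max E 1"
  \<comment> \<open>This maximizes \<open>4 * \<alpha> * c - 32 * \<alpha>\<^sup>2 * E'\<close>, the
    lower bound obtained for the mean capacity; the maximum is
    \<open>c\<^sup>2 / (8 * E')\<close>.\<close>
  define \<alpha> where "\<alpha> = c / (16 * E')"
  have E': "0 < E'" "E \<le> E'" by (auto simp: E'_def)
  have "c\<^sup>2 / (8 * E') \<le> integral\<^sup>L lborel (\<phi> N)" for N
  proof -
    let ?M = "slice_mass f N (P N) (\<nu> N)" and ?J = "slice_energy u f N (P N) (\<nu> N)"
    have \<alpha>: "0 \<le> \<alpha>" using E' \<open>c > 0\<close> by (simp add: \<alpha>_def)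
    have int: "integrable lborel ?M" "integrable lborel ?J"
      using integral_slice_mass(1) integral_slice_energy(1) \<nu> by blast+
    have "2 * \<alpha> * (2 * c) \<le> 2 * \<alpha> * integral\<^sup>L lborel ?M"
      unfolding integral_slice_mass using mass[of N] \<alpha> by (intro mult_left_mono) auto
    also have "\<dots> = (\<integral>p. 2 * \<alpha> * ?M p \<partial>lborel)" by simp
    also have "\<dots> \<le> (\<integral>p. \<alpha>\<^sup>2 * ?J p + \<phi> N p \<partial>lborel)"
      using int int_\<phi>[of N]
      by (intro integral_mono cap(3) Bochner_Integration.integrable_add integrable_mult_right)
    also have "\<dots> = \<alpha>\<^sup>2 * integral\<^sup>L lborel ?J + integral\<^sup>L lborel (\<phi> N)"
      using int int_\<phi>[of N] by simp
    also have "\<dots> \<le> \<alpha>\<^sup>2 * (32 * E') + integral\<^sup>L lborel (\<phi> N)"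
      using integral_slice_energy(2)[of "\<nu> N" u f N "P N"] \<nu> energy[of N] E'(2)
      by (intro add_right_mono mult_left_mono) auto
    finally have "2 * \<alpha> * (2 * c) - \<alpha>\<^sup>2 * (32 * E') \<le> integral\<^sup>L lborel (\<phi> N)" by simp
    moreover have "2 * \<alpha> * (2 * c) - \<alpha>\<^sup>2 * (32 * E') = c\<^sup>2 / (8 * E')"
      using E'(1) by (simp add: \<alpha>_def field_simps power2_eq_square)
    ultimately show ?thesis by simp
  qed
  then have "c\<^sup>2 / (8 * E') \<le> 0" by (intro LIMSEQ_le_const[OF lim]) auto
  then show False using \<open>c > 0\<close> E'(1) by (simp add: field_simps)
qed

subsection \<open>Accumulating slices at a point\<close>

text \<open>Closed at both ends, so that compactness passes to the pieces of \<open>K\<close>;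
  consecutive annuli share boundary points.\<close>

definition annulus :: "real \<Rightarrow> nat \<Rightarrow> real set" where
  "annulus x k = {y. (1/2) ^ Suc k \<le> \<bar>y - x\<bar> \<and> \<bar>y - x\<bar> \<le> (1/2) ^ k}"

lemma closed_annulus: "closed (annulus x k)"
  unfolding annulus_def by (intro closed_Collect_conj closed_Collect_le continuous_intros)

lemma punctured_ball_subset_annuli: "ball x ((1/2) ^ m) - {x} \<subseteq> (\<Union>k\<in>{m..}. annulus x k)"
proof
  fix y assume y: "y \<in> ball x ((1/2) ^ m) - {x}"
  then have d: "0 < \<bar>y - x\<bar>" "\<bar>y - x\<bar> < (1/2) ^ m" by (auto simp: dist_real_def abs_minus_commute)
  define R where "R k \<longleftrightarrow> (1/2) ^ Suc k \<le> \<bar>y - x\<bar>" for k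
  define k where "k = (LEAST k. R k)"
  obtain n where n: "(1/2) ^ n < \<bar>y - x\<bar>" using real_arch_pow_inv[OF d(1), of "1/2"] by auto
  have "(1/2::real) ^ Suc n \<le> (1/2) ^ n" by simp
  then have "R n" unfolding R_def using n by linarith
  then have "R k" unfolding k_def by (rule LeastI)
  have low: "\<bar>y - x\<bar> < (1/2) ^ Suc j" if "j < k" for j
    using not_less_Least[of j R] that unfolding k_def R_def by simp
  have "(1/2::real) ^ Suc k < (1/2) ^ m" using \<open>R k\<close> d(2) unfolding R_def by (rule order_le_less_trans)
  then have "m < Suc k" by (subst (asm) power_strict_decreasing_iff) auto
  have "\<bar>y - x\<bar> \<le> (1/2) ^ k"
  proof (cases "k = m")
    case True
    then show ?thesis using d(2) by simp
  next
    case False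
    then have "k - 1 < k" "Suc (k - 1) = k" using \<open>m < Suc k\<close> by auto
    then show ?thesis using low[of "k - 1"] by simp
  qed
  then have "y \<in> annulus x k" using \<open>R k\<close> by (simp add: annulus_def R_def)
  then show "y \<in> (\<Union>k\<in>{m..}. annulus x k)" using \<open>m < Suc k\<close> by auto
qed

text \<open>Only finitely many pieces leave a given closed ball around \<open>x\<close>, so the
  union is an intersection of closed sets.\<close>

lemma annuli_union_compact:
  fixes \<kappa> :: "nat \<Rightarrow> nat"
  assumes F: "\<And>n. compact (F n)" "\<And>n. F n \<subseteq> annulus x (\<kappa> n)" and "strict_mono \<kappa>"
  shows "compact (insert x (\<Union>n. F n))"
proof -
  have near: "\<bar>y - x\<bar> \<le> (1/2) ^ n" if "y \<in> F n" for y n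
  proof -
    have "\<bar>y - x\<bar> \<le> (1/2) ^ \<kappa> n" using F(2) that by (auto simp: annulus_def)
    also have "\<dots> \<le> (1/2) ^ n" using seq_suble[OF assms(3)] by (intro power_decreasing) auto
    finally show ?thesis .
  qed
  have "insert x (\<Union>n. F n) = (\<Inter>N. cball x ((1/2) ^ N) \<union> (\<Union>n\<in>{..N}. F n))" (is "?L = ?R")
  proof
    show "?L \<subseteq> ?R"
    proof (rule subsetI, rule INT_I)
      fix y N assume "y \<in> ?L"
      then consider "y = x" | n where "y \<in> F n" by blast
      then show "y \<in> cball x ((1/2) ^ N) \<union> (\<Union>n\<in>{..N}. F n)"
      proof cases
        case (2 n)
        show ?thesis
        proof (cases "n \<le> N")
          case False
          then have "(1/2::real) ^ n \<le> (1/2) ^ N" by (intro power_decreasing) auto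
          with near[OF 2] have "\<bar>y - x\<bar> \<le> (1/2) ^ N" by (rule order_trans)
          then show ?thesis by (simp add: dist_real_def abs_minus_commute)
        qed (use 2 in auto)
      qed simp
    qed
    show "?R \<subseteq> ?L"
    proof
      fix y assume y: "y \<in> ?R"
      show "y \<in> ?L"
      proof (cases "y = x")
        case False
        then obtain N where "(1/2) ^ N < \<bar>y - x\<bar>" using real_arch_pow_inv[of "\<bar>y - x\<bar>" "1/2"] by auto
        then have "y \<notin> cball x ((1/2) ^ N)" by (simp add: dist_real_def abs_minus_commute)
        then show ?thesis using y by blast
      qed simp
    qed
  qed
  moreover have "closed (cball x ((1/2) ^ N) \<union> (\<Union>n\<in>{..N}. F n))" for N
    using F(1) by (intro closed_Un closed_cball closed_UN) (auto intro: compact_imp_closed)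
  ultimately have "closed (insert x (\<Union>n. F n))" by (simp add: closed_INT)
  moreover have "insert x (\<Union>n. F n) \<subseteq> cball x 1"
  proof -
    have "F n \<subseteq> cball x 1" for n
    proof
      fix y assume "y \<in> F n"
      then have "\<bar>y - x\<bar> \<le> (1/2) ^ n" by (rule near)
      also have "\<dots> \<le> 1" by (intro power_le_one) auto
      finally show "y \<in> cball x 1" by (simp add: dist_real_def abs_minus_commute)
    qed
    then show ?thesis by auto
  qed
  ultimately show ?thesis
    using bounded_subset[OF bounded_cball] by (simp add: compact_eq_bounded_closed)
qed

text \<open>Strictly inside its annulus a point has a neighbourhood meeting only its own piece. The
  exceptions are \<open>x\<close> and the endpoints of the annuli, a countable set.\<close>

lemma annuli_union_nearly_locally_lipschitz:
  fixes \<kappa> :: "nat \<Rightarrow> nat"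
  assumes F: "\<And>n. F n \<subseteq> annulus x (\<kappa> n)" and "strict_mono \<kappa>"
    and lip: "\<And>n. L-lipschitz_on (F n) f"
  shows "nearly_locally_lipschitz_on (insert x (\<Union>n. F n)) f"
proof -
  let ?F = "insert x (\<Union>n. F n)"
  define C where "C = insert x (\<Union>k. {x + (1/2) ^ k, x - (1/2) ^ k})"
  have "countable C" unfolding C_def by auto
  have "\<exists>r>0. \<exists>L. L-lipschitz_on (?F \<inter> ball y r) f" if y: "y \<in> ?F" "y \<notin> C" for y
  proof -
    obtain n where n: "y \<in> F n" using y by (auto simp: C_def)
    define k where "k = \<kappa> n"
    have edge: "\<bar>y - x\<bar> \<noteq> (1/2) ^ j" for j
    proof
      assume "\<bar>y - x\<bar> = (1/2) ^ j"
      then have "y = x + (1/2) ^ j \<or> y = x - (1/2) ^ j" by (auto simp: abs_if split: if_splits)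
      then show False using y(2) unfolding C_def by blast
    qed
    have "y \<in> annulus x k" using F n by (auto simp: k_def)
    then have yk: "(1/2) ^ Suc k < \<bar>y - x\<bar>" "\<bar>y - x\<bar> < (1/2) ^ k"
      using edge[of "Suc k"] edge[of k] unfolding annulus_def by auto
    define r where "r = min (\<bar>y - x\<bar> - (1/2) ^ Suc k) ((1/2) ^ k - \<bar>y - x\<bar>)"
    have "0 < r" using yk by (simp add: r_def)
    have "?F \<inter> ball y r \<subseteq> F n"
    proof
      fix z assume z: "z \<in> ?F \<inter> ball y r"
      then have "\<bar>z - y\<bar> < r" by (simp add: dist_real_def abs_minus_commute)
      then have zk: "(1/2) ^ Suc k < \<bar>z - x\<bar>" "\<bar>z - x\<bar> < (1/2) ^ k" unfolding r_def by linarith+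
      have "0 < \<bar>z - x\<bar>" by (rule less_trans[OF _ zk(1)]) simp
      then obtain m where m: "z \<in> F m" using z by auto
      then have zm: "(1/2) ^ Suc (\<kappa> m) \<le> \<bar>z - x\<bar>" "\<bar>z - x\<bar> \<le> (1/2) ^ \<kappa> m"
        using F[of m] by (auto simp: annulus_def)
      \<comment> \<open>An interior point of one annulus lies in no other, and
        \<open>\<kappa>\<close> is injective, so the pieces coincide.\<close>
      have "(1/2::real) ^ Suc (\<kappa> m) < (1/2) ^ k" "(1/2::real) ^ Suc k < (1/2) ^ \<kappa> m"
        using zk zm by linarith+
      then have "k < Suc (\<kappa> m)" "\<kappa> m < Suc k"
        by (subst (asm) (1 2) power_strict_decreasing_iff; simp)+
      then have "\<kappa> m = \<kappa> n" by (simp add: k_def)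
      then have "m = n" using strict_mono_eq[OF assms(2)] by blast
      then show "z \<in> F n" using m by simp
    qed
    then have "L-lipschitz_on (?F \<inter> ball y r) f" by (rule lipschitz_on_subset[OF lip])
    then show ?thesis using \<open>0 < r\<close> by blast
  qed
  then have "{y \<in> ?F. \<not> (\<exists>r>0. \<exists>L. L-lipschitz_on (?F \<inter> ball y r) f)} \<subseteq> C" by blast
  then show ?thesis
    unfolding nearly_locally_lipschitz_on_def using \<open>countable C\<close> by (rule countable_subset)
qed

text \<open>Otherwise finitely many balls cover \<open>K\<close>, each null for an exponent below
  \<open>s\<close>; the largest of these exponents is still below \<open>s\<close> and makes the
  whole graph null.\<close>

lemma exists_point_of_full_dimension:
  assumes "compact K" "0 < s" and full: "\<And>t. 0 \<le> t \<Longrightarrow> t < s \<Longrightarrow> hausdorff_measure t (graph_on K f) \<noteq> 0"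
  shows "\<exists>x\<in>K. \<forall>r>0. \<forall>t\<ge>0. t < s \<longrightarrow> hausdorff_measure t (graph_on (K \<inter> ball x r) f) \<noteq> 0"
proof (rule ccontr)
  assume "\<not> ?thesis"
  then have "\<forall>x\<in>K. \<exists>r t. 0 < r \<and> 0 \<le> t \<and> t < s \<and> hausdorff_measure t (graph_on (K \<inter> ball x r) f) = 0"
    by blast
  then obtain r t where rt: "\<And>x. x \<in> K \<Longrightarrow> 0 < r x \<and> 0 \<le> t x \<and> t x < s \<and>
      hausdorff_measure (t x) (graph_on (K \<inter> ball x (r x)) f) = 0" by metis
  have op: "open (ball x (r x))" for x by simp
  have cov: "K \<subseteq> (\<Union>x\<in>K. ball x (r x))" using rt by force
  obtain X where X: "X \<subseteq> K" "finite X" "K \<subseteq> (\<Union>x\<in>X. ball x (r x))"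
    by (rule compactE_image[where f = "\<lambda>x. ball x (r x)", OF assms(1) op cov])
  \<comment> \<open>The entry \<open>0\<close> keeps the maximum defined and nonnegative for an
    empty cover.\<close>
  define T where "T = Max (insert 0 (t ` X))"
  have T: "0 \<le> T" "\<And>x. x \<in> X \<Longrightarrow> t x \<le> T" unfolding T_def using X(2) by (auto intro: Max_ge)
  have "T < s" unfolding T_def using X rt assms(2) by (subst Max_less_iff) auto
  have "hausdorff_measure T (\<Union>x\<in>X. graph_on (K \<inter> ball x (r x)) f) = 0"
  proof (rule hausdorff_measure_null_countable_UN)
    fix x assume "x \<in> X"
    then show "hausdorff_measure T (graph_on (K \<inter> ball x (r x)) f) = 0"
      using rt[of x] X(1) T(2)[of x] hausdorff_measure_null_exponent by blast
  qed (use X(2) in \<open>auto intro: countable_finite\<close>)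
  moreover have "graph_on K f \<subseteq> (\<Union>x\<in>X. graph_on (K \<inter> ball x (r x)) f)"
    using X(3) unfolding graph_on_def by blast
  ultimately have "hausdorff_measure T (graph_on K f) = 0" by (rule hausdorff_measure_null_mono[rotated])
  then show False using full[OF T(1) \<open>T < s\<close>] by simp
qed

section \<open>Assembly of the compact set\<close>

theorem theorem3p4:
  fixes K :: "real set" and s :: real and f :: "real \<Rightarrow> real"
  assumes "compact K" and "K \<subseteq> {0..1}"
    and "1 < s" and "s \<le> 2"
    and "f \<in> H_class K s"
  shows "\<exists>F. compact F \<and> F \<subseteq> K \<and> hausdorff_dim F = ereal (s - 1)
             \<and> nearly_locally_lipschitz_on F f"
proof -
  have cont: "continuous_on K f" and dim: "hausdorff_dim (graph_on K f) = ereal s"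
    using assms(5) by (auto simp: H_class_def)
  have "0 < s" using assms(3) by simp
  from exists_point_of_full_dimension[OF assms(1) this hausdorff_measure_below_dim[OF dim]]
  obtain x where x: "x \<in> K" and full: "\<And>r t. 0 < r \<Longrightarrow> 0 \<le> t \<Longrightarrow> t < s \<Longrightarrow>
      hausdorff_measure t (graph_on (K \<inter> ball x r) f) \<noteq> 0" by blast
  define A where "A k = K \<inter> annulus x k" for k
  have A: "compact (A k)" "A k \<subseteq> K" for k
    unfolding A_def using assms(1) closed_annulus by (auto intro: compact_Int_closed)
  \<comment> \<open>If all annuli from \<open>m\<close> on were null, so would be the graph over a
    ball around \<open>x\<close>, the center adding one point only.\<close>
  have large: "\<exists>k\<ge>m. hausdorff_measure t (graph_on (A k) f) \<noteq> 0" if t: "0 \<le> t" "t < s" for t m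
  proof (rule ccontr)
    assume "\<not> ?thesis"
    then have "hausdorff_measure t (\<Union>k\<in>{m..}. graph_on (A k) f) = 0"
      by (intro hausdorff_measure_null_countable_UN) auto
    then have "hausdorff_measure t ({(x, f x)} \<union> (\<Union>k\<in>{m..}. graph_on (A k) f)) = 0"
      by (intro hausdorff_measure_null_Un hausdorff_measure_singleton)
    moreover have "graph_on (K \<inter> ball x ((1/2) ^ m)) f \<subseteq> {(x, f x)} \<union> (\<Union>k\<in>{m..}. graph_on (A k) f)"
      using punctured_ball_subset_annuli[of x m] unfolding graph_on_def A_def by blast
    ultimately have "hausdorff_measure t (graph_on (K \<inter> ball x ((1/2) ^ m)) f) = 0"
      by (rule hausdorff_measure_null_mono[rotated])
    then show False using full[of "(1/2) ^ m" t] t by simp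
  qed
  \<comment> \<open>Exponents tending to \<open>s - 1\<close> from below; the double
    \<open>Suc\<close> keeps \<open>u 0\<close> positive.\<close>
  define u where "u n = (s - 1) * (1 - inverse (real (Suc (Suc n))))" for n
  have u: "0 < u n" "u n < s - 1" for n using assms(3) by (auto simp: u_def intro!: mult_pos_pos inverse_less_1_iff[THEN iffD2])
  \<comment> \<open>The midpoint of \<open>u n + 1\<close> and \<open>s\<close> leaves the room that
    the energy argument needs on both sides.\<close>
  define t where "t n = (u n + 1 + s) / 2" for n
  have t: "0 \<le> t n" "t n < s" "u n + 1 < t n" for n using u[of n] by (auto simp: t_def)
  \<comment> \<open>Strict growth of \<open>\<kappa>\<close> gives each exponent its own annulus and
    lets the annuli shrink to \<open>x\<close>.\<close>
  have "\<exists>\<kappa>. \<forall>n. hausdorff_measure (t n) (graph_on (A (\<kappa> n)) f) \<noteq> 0 \<and> \<kappa> n < \<kappa> (Suc n)"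
  proof (rule dependent_nat_choice)
    show "\<exists>k. hausdorff_measure (t 0) (graph_on (A k) f) \<noteq> 0" using large[of "t 0"] t by blast
    show "\<exists>l. hausdorff_measure (t (Suc n)) (graph_on (A l) f) \<noteq> 0 \<and> k < l" for k n
      using large[of "t (Suc n)" "Suc k"] t Suc_le_lessD by blast
  qed
  then obtain \<kappa> where \<kappa>: "\<And>n. hausdorff_measure (t n) (graph_on (A (\<kappa> n)) f) \<noteq> 0"
    and "\<And>n. \<kappa> n < \<kappa> (Suc n)" by blast
  then have mono: "strict_mono \<kappa>" by (simp add: strict_mono_Suc_iff)
  \<comment> \<open>Exponents decreasing to \<open>s\<close>; shifted by 1 they bound the dimension
    of all slices by \<open>s - 1\<close>.\<close>
  define V where "V = range (\<lambda>j::nat. s + 1 / (real j + 1))"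
  have V: "countable V" "\<And>v. v \<in> V \<Longrightarrow> 1 < v" "\<And>v. v \<in> V \<Longrightarrow> s < v"
    using assms(3) by (auto simp: V_def add_pos_pos intro: less_trans[of 1 s])
  define slice where "slice n a b = {y \<in> A (\<kappa> n). f y = a * y + b}" for n a b
  have "\<exists>a\<in>{0..1}. \<exists>b. hausdorff_measure (u n) (slice n a b) \<noteq> 0 \<and>
      (\<forall>v\<in>V. hausdorff_measure (v - 1) (slice n a b) = 0)" for n
    unfolding slice_def
  proof (rule exists_large_slice)
    show "continuous_on (A (\<kappa> n)) f" by (rule continuous_on_subset[OF cont A(2)])
    show "hausdorff_measure v (graph_on (A (\<kappa> n)) f) = 0" if "v \<in> V" for v
      using hausdorff_measure_null_mono[OF _ hausdorff_measure_above_dim[OF dim V(3)[OF that]]] A(2)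
      unfolding graph_on_def by (meson image_mono)
  qed (fact A(1) order_trans[OF A(2) assms(2)] u(1) t(3) \<kappa> V(1,2))+
  then obtain a b where a: "\<And>n. a n \<in> {0..1}" and
    slice: "\<And>n. hausdorff_measure (u n) (slice n (a n) (b n)) \<noteq> 0"
      "\<And>n v. v \<in> V \<Longrightarrow> hausdorff_measure (v - 1) (slice n (a n) (b n)) = 0"
    by metis
  define F where "F n = slice n (a n) (b n)" for n
  have F_sub: "F n \<subseteq> A (\<kappa> n)" for n by (auto simp: F_def slice_def)
  then have F_ann: "F n \<subseteq> annulus x (\<kappa> n)" for n by (auto simp: A_def)
  have F_comp: "compact (F n)" for n
  proof -
    have "closed {y \<in> A (\<kappa> n). f y - a n * y = b n}"
      by (intro continuous_closed_preimage_constant continuous_intros compact_imp_closed A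
          continuous_on_subset[OF cont])
    moreover have "{y \<in> A (\<kappa> n). f y - a n * y = b n} = F n" by (auto simp: F_def slice_def)
    ultimately have "compact (A (\<kappa> n) \<inter> F n)" using A(1) by (metis compact_Int_closed)
    then show ?thesis using F_sub[of n] by (simp add: Int_absorb1)
  qed
  have lip: "1-lipschitz_on (F n) f" for n
  proof (rule lipschitz_onI)
    fix y z assume "y \<in> F n" "z \<in> F n"
    then have "f y - f z = a n * (y - z)" by (simp add: F_def slice_def algebra_simps)
    then have "\<bar>f y - f z\<bar> = \<bar>a n\<bar> * \<bar>y - z\<bar>" by (simp add: abs_mult)
    also have "\<dots> \<le> 1 * \<bar>y - z\<bar>" using a[of n] by (intro mult_right_mono) auto
    finally show "dist (f y) (f z) \<le> 1 * dist y z" by (simp add: dist_real_def)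
  qed simp
  let ?F = "insert x (\<Union>n. F n)"
  have "hausdorff_dim ?F = ereal (s - 1)"
  proof (rule hausdorff_dim_eqI)
    fix j :: nat
    have "s + 1 / (real j + 1) \<in> V" by (auto simp: V_def)
    then have "hausdorff_measure (s - 1 + 1 / (real j + 1)) (F n) = 0" for n
      using slice(2)[of "s + 1 / (real j + 1)" n] by (simp add: F_def algebra_simps)
    then have "hausdorff_measure (s - 1 + 1 / (real j + 1)) ({x} \<union> (\<Union>n. F n)) = 0"
      by (intro hausdorff_measure_null_Un hausdorff_measure_null_UN hausdorff_measure_singleton)
    then show "hausdorff_measure (s - 1 + 1 / (real j + 1)) ?F = 0" by simp
  next
    fix v assume v: "0 \<le> v" "v < s - 1"
    show "hausdorff_measure v ?F \<noteq> 0"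
    proof
      assume "hausdorff_measure v ?F = 0"
      then have null: "hausdorff_measure v (F n) = 0" for n
        by (rule hausdorff_measure_null_mono[rotated]) auto
      have "(\<lambda>n. u n) \<longlonglongrightarrow> (s - 1) * (1 - 0)"
        unfolding u_def
        by (intro tendsto_mult tendsto_diff tendsto_const LIMSEQ_Suc[OF LIMSEQ_inverse_real_of_nat])
      then have "eventually (\<lambda>n. v < u n) sequentially" using v(2) by (intro order_tendstoD(1)) auto
      then obtain n where "v < u n" by (auto simp: eventually_sequentially)
      then have "hausdorff_measure (u n) (F n) = 0"
        using hausdorff_measure_null_exponent[OF null, of "u n" n] by simp
      then show False using slice(1)[of n] by (simp add: F_def)
    qed
  qed (use assms(3) in simp)
  moreover have "?F \<subseteq> K" using x F_sub A(2) by blast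
  ultimately show ?thesis
    using annuli_union_compact[OF F_comp F_ann mono]
      annuli_union_nearly_locally_lipschitz[OF F_ann mono lip] by blast
qed

end
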